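(* Let $E\subset\mathbb{C}$ be a compact set satisfying the Łojasiewicz-Siciak condition. Assume also that the Green function $g_E$ is Hölder continuous with exponent $\alpha\in(0,1]$. Then there exist positive constants $C,\kappa$, depending only on the set $E$, and, for each sufficiently large $n\in\mathbb{N}$, a polynomial $P_n$ of degree $n+1$ such that (i) $\chi(E,\mathcal{K}(P_n))\le C\left(n^{-1}\log(n+1)\right)^{\kappa}$ if $\alpha\in[1/2,1]$; (ii) $\chi(E,\mathcal{K}(P_n))\le C\,n^{-2\alpha\kappa}$ if $\alpha\in(0,1/2)$.
   Context: For compact $E\subset\mathbb{C}$, $\widehat E=\{z\in\mathbb{C}:|p(z)|\le\max_{w\in E}|p(w)|\text{ for every complex polynomial }p\}$. $E$ is regular if the Green function of $D_\infty=\mathbb{C}\setminus\widehat E$ with pole at infinity exists: a function $g_E$, harmonic and positive in $D_\infty$, with $g_E(z)\to0$ as $z\to\partial D_\infty$ and $g_E(z)-\log|z|$ tending to a finite number as $z\to\infty$. It is extended by $0$ on $\widehat E$ to a continuous function on $\mathbb{C}$. $g_E$ is Hölder continuous with constant $A>0$ and exponent $\alpha$ if for all $\delta>0$ and $z\in\mathbb{C}$, $\mathrm{dist}(z,E)<\delta$ implies $g_E(z)\le A\delta^\alpha$. Łojasiewicz-Siciak condition: a compact regular set $E$ satisfies it if for a bounded neighbourhood $U$ of $E$ (equivalently, for every such $U$, with constants depending on $U$) there exist positive constants $B,\beta$ such that $g_E(z)\ge B(\mathrm{dist}(z,E))^\beta$ for all $z\in U$. For a complex polynomial $P$ of degree at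 least $2$, the filled-in Julia set is $\mathcal{K}(P)=\{z\in\mathbb{C}:(P^{\circ n}(z))_{n\ge1}\text{ is bounded}\}$, where $P^{\circ n}$ is the $n$-th iterate. $\chi$ is the Hausdorff metric on nonempty compact subsets of $\mathbb{C}$. *)

theory Defs
  imports "HOL-Analysis.Analysis" "HOL-Computational_Algebra.Polynomial"
begin

text \<open>
  For nonempty compact \<open>E\<close> the supremum is attained, so it is the maximum of \<open>|p|\<close> over \<open>E\<close>.
\<close>

definition polynomial_hull :: "complex set \<Rightarrow> complex set" where
  "polynomial_hull E =
     {z. \<forall>p :: complex poly. norm (poly p z) \<le> (SUP w\<in>E. norm (poly p w))}"

text \<open>
  Twice continuously differentiable in the real sense, with vanishing Laplacian:
  \<open>ux\<close>, \<open>uy\<close> are the first partial derivatives of \<open>u\<close> with respect to the real and the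
  imaginary part, \<open>uxx\<close>, \<open>uxy\<close>, \<open>uyx\<close>, \<open>uyy\<close> the second ones.
\<close>

definition harmonic_on :: "(complex \<Rightarrow> real) \<Rightarrow> complex set \<Rightarrow> bool"
    (infixl "harmonic'_on" 50) where
  "u harmonic_on S \<longleftrightarrow> open S \<and>
     (\<exists>ux uy uxx uxy uyx uyy :: complex \<Rightarrow> real.
        (\<forall>z\<in>S. (u has_derivative (\<lambda>h. ux z * Re h + uy z * Im h)) (at z) \<and>
               (ux has_derivative (\<lambda>h. uxx z * Re h + uxy z * Im h)) (at z) \<and>
               (uy has_derivative (\<lambda>h. uyx z * Re h + uyy z * Im h)) (at z) \<and>
               uxx z + uyy z = 0) \<and>
        continuous_on S uxx \<and> continuous_on S uxy \<and>
        continuous_on S uyx \<and> continuous_on S uyy)"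

definition is_green_function :: "complex set \<Rightarrow> (complex \<Rightarrow> real) \<Rightarrow> bool" where
  "is_green_function E g \<longleftrightarrow>
     (let D = - polynomial_hull E in
        g harmonic_on D \<and>
        (\<forall>z\<in>D. g z > 0) \<and>
        (\<forall>\<zeta>\<in>frontier D. (g \<longlongrightarrow> 0) (at \<zeta> within D)) \<and>
        (\<exists>l. ((\<lambda>z. g z - ln (norm z)) \<longlongrightarrow> l) at_infinity) \<and>
        (\<forall>z\<in>polynomial_hull E. g z = 0))"

definition regular_set :: "complex set \<Rightarrow> bool" where
  "regular_set E \<longleftrightarrow> (\<exists>g. is_green_function E g)"

text \<open>
  By the maximum principle a nonempty compact set has at most one Green function, so the
  choice is immaterial. The value is only meaningful for regular sets.
\<close>

definition green :: "complex set \<Rightarrow> complex \<Rightarrow> real" where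
  "green E = (SOME g. is_green_function E g)"

definition green_holder :: "complex set \<Rightarrow> real \<Rightarrow> real \<Rightarrow> bool" where
  "green_holder E A \<alpha> \<longleftrightarrow>
     A > 0 \<and> (\<forall>\<delta>>0. \<forall>z. infdist z E < \<delta> \<longrightarrow> green E z \<le> A * \<delta> powr \<alpha>)"

definition lojasiewicz_siciak :: "complex set \<Rightarrow> bool" where
  "lojasiewicz_siciak E \<longleftrightarrow> compact E \<and> regular_set E \<and>
     (\<exists>U. bounded U \<and> E \<subseteq> interior U \<and>
        (\<exists>B>0. \<exists>\<beta>>0. \<forall>z\<in>U. green E z \<ge> B * infdist z E powr \<beta>))"

definition filled_julia :: "complex poly \<Rightarrow> complex set" where
  "filled_julia P = {z. bounded ((\<lambda>n. (poly P ^^ n) z) ` {1..})}"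

text \<open>Intended for nonempty compact sets; there both suprema are finite.\<close>

definition hausdorff_dist :: "complex set \<Rightarrow> complex set \<Rightarrow> real" where
  "hausdorff_dist A B = max (SUP x\<in>A. infdist x B) (SUP y\<in>B. infdist y A)"

end

theory Submission
  imports Defs "HOL-Real_Asymp.Real_Asymp"
begin

text \<open>
  Let \<open>\<omega>\<close> be a polynomial of degree \<open>m\<close> whose zeros are nearly Fekete points of \<open>E\<close>, let
  \<open>M = max |\<omega>|\<close> over \<open>E\<close>, and fix \<open>a \<in> E\<close>. The approximating polynomial is
  \<open>P = a + c \<omega>\<close> with a small constant \<open>c\<close>. It maps a thin neighbourhood
  \<open>{dist(z, E) \<le> \<delta>}\<close> of \<open>E\<close> into itself, so that \<open>E \<subseteq> \<K>(P)\<close>, and it sends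
  every point at distance at least \<open>\<epsilon>\<close> from \<open>E\<close> so far away that its orbit escapes. This
  works as soon as \<open>|\<omega>|/M\<close> is at most a constant on the thin neighbourhood and exponentially
  large in a power of \<open>m\<close> at distance \<open>\<epsilon>\<close>.

  Both estimates come from comparing \<open>log |\<omega>|\<close> with \<open>m g\<close>, where \<open>g\<close> is the Green
  function. The upper one is the Bernstein-Walsh inequality \<open>|\<omega>| \<le> M exp (m g)\<close>
  (\<open>bernstein_walsh\<close>). The lower one (\<open>green_lower_bound_poly\<close>) is the minimum principle for
  \<open>log |\<omega>| - m g\<close> on \<open>{dist(z, E) > \<delta>}\<close>; what it needs is that \<open>|\<omega>|\<close> is not
  small on the boundary of that set. Here the Fekete property enters
  (\<open>near_fekete_node_poly_lower\<close>): the Lagrange basis polynomials of the nodes sum to \<open>1\<close>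
  everywhere and are bounded by \<open>2\<close> on \<open>E\<close>, which gives \<open>|\<omega>| \<ge> M \<delta> / (2 d m)\<close> at
  distance \<open>\<delta>\<close>, with \<open>d\<close> a bound on the distances in \<open>E\<close>.

  The Hoelder exponent \<open>\<alpha>\<close> only governs the choice of \<open>\<delta>\<close>: a fixed negative power of
  \<open>m\<close> makes \<open>m g\<close> bounded on the thin neighbourhood, and the price is a factor polynomial
  in \<open>m\<close>. The Lojasiewicz-Siciak bound \<open>g \<ge> B \<epsilon>^\<beta>\<close> with \<open>\<epsilon> = m^(-1/(2\<beta>))\<close>
  gives the gain \<open>exp (B \<surd>m)\<close>, which beats every power of \<open>m\<close>. Hence for every
  \<open>\<alpha>\<close> the Hausdorff distance is eventually at most \<open>m^(-1/(2\<beta>))\<close>, and this implies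
  both asserted rates with \<open>\<kappa> = 1/(2\<beta>)\<close> and \<open>C = 1\<close>.

  The Lojasiewicz-Siciak condition also forces \<open>E\<close> to be polynomially convex
  (\<open>lojasiewicz_siciak_polynomial_hull\<close>). This is what makes the domain of \<open>g\<close> the full
  complement of \<open>E\<close>.
\<close>

section \<open>Harmonic functions and the maximum principle\<close>

lemma second_derivative_not_pos_at_local_max:
  fixes f f' :: "real \<Rightarrow> real"
  assumes "d > 0"
    and f: "\<And>t. \<bar>t\<bar> < d \<Longrightarrow> (f has_real_derivative f' t) (at t)"
    and f': "(f' has_real_derivative D) (at 0)"
    and max: "\<And>t. \<bar>t\<bar> < d \<Longrightarrow> f t \<le> f 0"
  shows "D \<le> 0"
proof (rule ccontr)
  assume "\<not> D \<le> 0"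
  have crit: "f' 0 = 0"
    using DERIV_local_max[OF f[of 0] \<open>d > 0\<close>] max \<open>d > 0\<close> by auto
  obtain e where "e > 0" and inc: "\<And>h. 0 < h \<Longrightarrow> h < e \<Longrightarrow> f' 0 < f' (0 + h)"
    using DERIV_pos_inc_right[OF f'] \<open>\<not> D \<le> 0\<close> by force
  define t where "t = min d e / 2"
  have t: "0 < t" "t < d" "t < e" using \<open>d > 0\<close> \<open>e > 0\<close> by (auto simp: t_def min_def)
  obtain s where s: "0 < s" "s < t" "f t - f 0 = (t - 0) * f' s"
    using MVT2[of 0 t f f'] f t by auto
  have "(t - 0) * f' s > 0" using inc[of s] crit s t by auto
  then show False using s max[of t] t by auto
qed

lemma has_derivative_along_line:
  fixes v :: "complex \<Rightarrow> real"
  assumes "(v has_derivative (\<lambda>h. a * Re h + b * Im h)) (at (z + of_real t * w))"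
  shows "((\<lambda>s. v (z + of_real s * w)) has_real_derivative (a * Re w + b * Im w)) (at t)"
proof -
  have "((\<lambda>s. z + of_real s * w) has_derivative (\<lambda>s. of_real s * w)) (at t)"
    by (auto intro!: derivative_eq_intros)
  from diff_chain_at[OF this assms]
  have "((\<lambda>s. v (z + of_real s * w)) has_derivative
      (\<lambda>h. a * Re (of_real h * w) + b * Im (of_real h * w))) (at t)"
    by (simp add: o_def)
  moreover have "(\<lambda>h. a * Re (of_real h * w) + b * Im (of_real h * w)) = (*) (a * Re w + b * Im w)"
    by (simp add: fun_eq_iff algebra_simps)
  ultimately show ?thesis
    by (simp add: has_field_derivative_def)
qed

lemma harmonic_onI:
  assumes "open S"
    and "\<And>z. z \<in> S \<Longrightarrow> (u has_derivative (\<lambda>h. ux z * Re h + uy z * Im h)) (at z)"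
    and "\<And>z. z \<in> S \<Longrightarrow> (ux has_derivative (\<lambda>h. uxx z * Re h + uxy z * Im h)) (at z)"
    and "\<And>z. z \<in> S \<Longrightarrow> (uy has_derivative (\<lambda>h. uyx z * Re h + uyy z * Im h)) (at z)"
    and "\<And>z. z \<in> S \<Longrightarrow> uxx z + uyy z = 0"
    and "continuous_on S uxx" "continuous_on S uxy" "continuous_on S uyx" "continuous_on S uyy"
  shows "u harmonic_on S"
  unfolding harmonic_on_def using assms(1)
  apply (rule conjI)
  apply (rule exI[of _ ux], rule exI[of _ uy], rule exI[of _ uxx], rule exI[of _ uxy],
      rule exI[of _ uyx], rule exI[of _ uyy])
  using assms(2-) by simp

text \<open>
  The Laplacian of \<open>u + \<eta> |z|^2\<close> is \<open>4 \<eta> > 0\<close>, while at a local maximum both second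
  derivatives along the coordinate axes are at most \<open>0\<close>.
\<close>

lemma harmonic_plus_square_no_local_max:
  assumes u: "u harmonic_on W" and z: "z \<in> W" and "\<eta> > 0" "d > 0"
    and max: "\<And>w. dist z w < d \<Longrightarrow> u w + \<eta> * (norm w)^2 \<le> u z + \<eta> * (norm z)^2"
  shows False
proof -
  from u obtain ux uy uxx uxy uyx uyy where "open W" and
    Du: "\<forall>z\<in>W. (u has_derivative (\<lambda>h. ux z * Re h + uy z * Im h)) (at z) \<and>
      (ux has_derivative (\<lambda>h. uxx z * Re h + uxy z * Im h)) (at z) \<and>
      (uy has_derivative (\<lambda>h. uyx z * Re h + uyy z * Im h)) (at z) \<and>
      uxx z + uyy z = 0"
    and Cu: "continuous_on W uxx" "continuous_on W uxy" "continuous_on W uyx" "continuous_on W uyy"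
    unfolding harmonic_on_def by blast
  note D = Du[THEN bspec, THEN conjunct1] Du[THEN bspec, THEN conjunct2, THEN conjunct1]
    Du[THEN bspec, THEN conjunct2, THEN conjunct2, THEN conjunct1]
    Du[THEN bspec, THEN conjunct2, THEN conjunct2, THEN conjunct2]
  obtain r where r: "r > 0" "ball z r \<subseteq> W"
    using \<open>open W\<close> z open_contains_ball by blast
  define e where "e = min d r"
  have "e > 0" using r \<open>d > 0\<close> by (simp add: e_def)
  have inW: "z + of_real t * w \<in> W" if "\<bar>t\<bar> < e" "norm w = 1" for t w
  proof -
    have "dist z (z + of_real t * w) < r" using that by (simp add: dist_norm norm_mult e_def)
    then show ?thesis using r by auto
  qed
  have near: "dist z (z + of_real t * w) < d" if "\<bar>t\<bar> < e" "norm w = 1" for t w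
    using that by (simp add: dist_norm norm_mult e_def)
  have "uxx z + 2 * \<eta> \<le> 0"
  proof (rule second_derivative_not_pos_at_local_max[OF \<open>e > 0\<close>])
    fix t :: real assume t: "\<bar>t\<bar> < e"
    show "((\<lambda>t. u (z + of_real t * 1) + \<eta> * ((Re z + t)^2 + (Im z)^2)) has_real_derivative
      (ux (z + of_real t * 1) + \<eta> * 2 * (Re z + t))) (at t)"
      using has_derivative_along_line[OF D(1)[OF inW[OF t, of 1]]]
      by (auto intro!: derivative_eq_intros)
    show "u (z + of_real t * 1) + \<eta> * ((Re z + t)^2 + (Im z)^2)
      \<le> u (z + of_real 0 * 1) + \<eta> * ((Re z + 0)^2 + (Im z)^2)"
      using max[OF near[OF t, of 1]] by (simp add: cmod_power2)
  next
    show "((\<lambda>t. ux (z + of_real t * 1) + \<eta> * 2 * (Re z + t)) has_real_derivative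
      (uxx z + 2 * \<eta>)) (at 0)"
      using D(2,3)[OF z] has_derivative_along_line[of ux "uxx z" "uxy z" z 0 1]
      by (auto intro!: derivative_eq_intros)
  qed
  moreover have "uyy z + 2 * \<eta> \<le> 0"
  proof (rule second_derivative_not_pos_at_local_max[OF \<open>e > 0\<close>])
    fix t :: real assume t: "\<bar>t\<bar> < e"
    show "((\<lambda>t. u (z + of_real t * \<i>) + \<eta> * ((Re z)^2 + (Im z + t)^2)) has_real_derivative
      (uy (z + of_real t * \<i>) + \<eta> * 2 * (Im z + t))) (at t)"
      using has_derivative_along_line[OF D(1)[OF inW[OF t, of \<i>]]]
      by (auto intro!: derivative_eq_intros)
    show "u (z + of_real t * \<i>) + \<eta> * ((Re z)^2 + (Im z + t)^2)
      \<le> u (z + of_real 0 * \<i>) + \<eta> * ((Re z)^2 + (Im z + 0)^2)"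
      using max[OF near[OF t, of \<i>]] by (simp add: cmod_power2)
  next
    show "((\<lambda>t. uy (z + of_real t * \<i>) + \<eta> * 2 * (Im z + t)) has_real_derivative
      (uyy z + 2 * \<eta>)) (at 0)"
      using D(2,3)[OF z] has_derivative_along_line[of uy "uyx z" "uyy z" z 0 \<i>]
      by (auto intro!: derivative_eq_intros)
  qed
  ultimately show False using D(4)[OF z] \<open>\<eta> > 0\<close> by auto
qed

lemma harmonic_on_imp_open: "u harmonic_on W \<Longrightarrow> open W"
  by (auto simp: harmonic_on_def)

lemma harmonic_on_imp_isCont: "u harmonic_on W \<Longrightarrow> z \<in> W \<Longrightarrow> isCont u z"
  unfolding harmonic_on_def using has_derivative_continuous by blast

lemma harmonic_on_subset:
  assumes u: "u harmonic_on W" and V: "open V" "V \<subseteq> W"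
  shows "u harmonic_on V"
proof -
  from u obtain ux uy uxx uxy uyx uyy where W: "open W" and
    Du: "\<forall>z\<in>W. (u has_derivative (\<lambda>h. ux z * Re h + uy z * Im h)) (at z) \<and>
      (ux has_derivative (\<lambda>h. uxx z * Re h + uxy z * Im h)) (at z) \<and>
      (uy has_derivative (\<lambda>h. uyx z * Re h + uyy z * Im h)) (at z) \<and>
      uxx z + uyy z = 0"
    and Cu: "continuous_on W uxx" "continuous_on W uxy" "continuous_on W uyx" "continuous_on W uyy"
    unfolding harmonic_on_def by blast
  note D = Du[THEN bspec, THEN conjunct1] Du[THEN bspec, THEN conjunct2, THEN conjunct1]
    Du[THEN bspec, THEN conjunct2, THEN conjunct2, THEN conjunct1]
    Du[THEN bspec, THEN conjunct2, THEN conjunct2, THEN conjunct2]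
  have sub: "z \<in> W" if "z \<in> V" for z using that V(2) by blast
  show ?thesis
    by (rule harmonic_onI[OF V(1) D(1)[OF sub] D(2)[OF sub] D(3)[OF sub] D(4)[OF sub]
          Cu[THEN continuous_on_subset, OF V(2)]])
qed

lemma harmonic_on_lincomb:
  assumes u: "u harmonic_on W" and v: "v harmonic_on W"
  shows "(\<lambda>z. a * u z + b * v z) harmonic_on W"
proof -
  from u obtain ux uy uxx uxy uyx uyy where W: "open W" and
    Du: "\<forall>z\<in>W. (u has_derivative (\<lambda>h. ux z * Re h + uy z * Im h)) (at z) \<and>
      (ux has_derivative (\<lambda>h. uxx z * Re h + uxy z * Im h)) (at z) \<and>
      (uy has_derivative (\<lambda>h. uyx z * Re h + uyy z * Im h)) (at z) \<and>
      uxx z + uyy z = 0"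
    and Cu: "continuous_on W uxx" "continuous_on W uxy" "continuous_on W uyx" "continuous_on W uyy"
    unfolding harmonic_on_def by blast
  note * = Du[THEN bspec, THEN conjunct1] Du[THEN bspec, THEN conjunct2, THEN conjunct1]
    Du[THEN bspec, THEN conjunct2, THEN conjunct2, THEN conjunct1]
    Du[THEN bspec, THEN conjunct2, THEN conjunct2, THEN conjunct2]
  from v obtain vx vy vxx vxy vyx vyy where 
    Dv: "\<forall>z\<in>W. (v has_derivative (\<lambda>h. vx z * Re h + vy z * Im h)) (at z) \<and>
      (vx has_derivative (\<lambda>h. vxx z * Re h + vxy z * Im h)) (at z) \<and>
      (vy has_derivative (\<lambda>h. vyx z * Re h + vyy z * Im h)) (at z) \<and>
      vxx z + vyy z = 0"
    and Cv: "continuous_on W vxx" "continuous_on W vxy" "continuous_on W vyx" "continuous_on W vyy"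
    unfolding harmonic_on_def by blast
  note ** = Dv[THEN bspec, THEN conjunct1] Dv[THEN bspec, THEN conjunct2, THEN conjunct1]
    Dv[THEN bspec, THEN conjunct2, THEN conjunct2, THEN conjunct1]
    Dv[THEN bspec, THEN conjunct2, THEN conjunct2, THEN conjunct2]
  have lin: "((\<lambda>z. a * f z + b * k z) has_derivative
      (\<lambda>h. (a * f1 + b * k1) * Re h + (a * f2 + b * k2) * Im h)) (at z)"
    if "(f has_derivative (\<lambda>h. f1 * Re h + f2 * Im h)) (at z)"
      "(k has_derivative (\<lambda>h. k1 * Re h + k2 * Im h)) (at z)"
    for f k :: "complex \<Rightarrow> real" and f1 f2 k1 k2 z
    by (rule derivative_eq_intros that refl | simp add: algebra_simps)+
  have lap: "(a * uxx z + b * vxx z) + (a * uyy z + b * vyy z) = 0" if "z \<in> W" for z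
  proof -
    have "(a * uxx z + b * vxx z) + (a * uyy z + b * vyy z)
      = a * (uxx z + uyy z) + b * (vxx z + vyy z)" by (simp add: algebra_simps)
    then show ?thesis using *(4)[OF that] **(4)[OF that] by simp
  qed
  show ?thesis
    by (rule harmonic_onI[OF W lin[OF *(1) **(1)] lin[OF *(2) **(2)] lin[OF *(3) **(3)] lap])
      (assumption | intro continuous_intros Cu Cv)+
qed

text \<open>
  With \<open>F = p'/p\<close>, the derivative of a local branch of \<open>log p\<close>, the partial derivatives of
  \<open>log |p|\<close> are \<open>Re F\<close> and \<open>- Im F\<close>, and the second ones are read off from \<open>F'\<close>.
\<close>

lemma harmonic_on_ln_norm_poly:
  fixes p :: "complex poly"
  assumes W: "open W" and nz: "\<And>z. z \<in> W \<Longrightarrow> poly p z \<noteq> 0"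
  shows "(\<lambda>z. ln (norm (poly p z))) harmonic_on W"
proof -
  define F where "F z = poly (pderiv p) z / poly p z" for z
  define F' where "F' z = (poly (pderiv (pderiv p)) z * poly p z
     - poly (pderiv p) z * poly (pderiv p) z) / (poly p z * poly p z)" for z
  have dF: "(F has_field_derivative F' z) (at z)" if "z \<in> W" for z
    unfolding F_def F'_def using nz[OF that]
    by (auto intro!: derivative_eq_intros)
  have du: "((\<lambda>z. ln (norm (poly p z))) has_derivative
      (\<lambda>h. Re (F z) * Re h + (- Im (F z)) * Im h)) (at z)" if "z \<in> W" for z
  proof -
    have n: "(poly p has_derivative (\<lambda>h. poly (pderiv p) z * h)) (at z)"
      using poly_DERIV[of p z] by (simp add: has_field_derivative_def)
    have "((\<lambda>z. ln (norm (poly p z))) has_derivative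
      (\<lambda>h. inner (poly (pderiv p) z * h) (sgn (poly p z)) / norm (poly p z))) (at z)"
      using nz[OF that] has_derivative_compose[OF n has_derivative_norm[OF nz[OF that]]]
      by (auto intro!: derivative_eq_intros simp: divide_inverse)
    moreover have "inner (poly (pderiv p) z * h) (sgn (poly p z)) / norm (poly p z)
        = Re (F z) * Re h + (- Im (F z)) * Im h" for h
    proof -
      have "inner (a * h) (sgn b) / norm b = Re (a / b * h)" if "b \<noteq> 0" for a b :: complex
      proof -
        have "a / b = a * cnj b / of_real ((norm b)^2)"
          using complex_div_cnj[of a b] by simp
        then have "Re (a / b * h) = Re (a * h * cnj b) / (norm b)^2"
          by (simp add: ac_simps Re_divide_of_real flip: of_real_power)
        also have "\<dots> = inner (a * h) (sgn b) / norm b"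
          by (simp add: sgn_div_norm inner_complex_def power2_eq_square divide_inverse
              algebra_simps)
        finally show ?thesis by simp
      qed
      from this[OF nz[OF that], of "poly (pderiv p) z"] show ?thesis
        by (simp only: F_def times_complex.sel mult_minus_left diff_conv_add_uminus)
    qed
    ultimately show ?thesis by simp
  qed
  have dRe: "((\<lambda>z. Re (F z)) has_derivative (\<lambda>h. Re (F' z) * Re h + (- Im (F' z)) * Im h)) (at z)"
    and dIm: "((\<lambda>z. - Im (F z)) has_derivative (\<lambda>h. (- Im (F' z)) * Re h + (- Re (F' z)) * Im h)) (at z)"
    if "z \<in> W" for z
    using dF[OF that] unfolding has_field_derivative_def
    by (auto intro!: derivative_eq_intros simp: algebra_simps)
  have cF: "continuous_on W F'"
    unfolding F'_def using nz by (auto intro!: continuous_intros)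
  show ?thesis
    by (rule harmonic_onI[OF W du dRe dIm]) (use cF in \<open>auto intro!: continuous_intros\<close>)
qed

text \<open>
  The boundary condition is one on upper limits, and the point at infinity counts as a boundary
  point. This form applies to functions such as \<open>log |p| - k g\<close> that tend to \<open>-\<infinity>\<close> at
  zeros of \<open>p\<close>, and to unbounded \<open>W\<close>. If \<open>u\<close> exceeded \<open>c\<close> somewhere, the set \<open>K\<close> where it
  exceeds \<open>c\<close> by a definite amount would be compact in \<open>W\<close>, and \<open>u + \<eta> |z|^2\<close> with a small
  \<open>\<eta>\<close> would have a local maximum at a point of \<open>K\<close>.
\<close>

lemma harmonic_max_principle:
  assumes u: "u harmonic_on W"
    and boundary: "\<And>\<zeta> e. \<zeta> \<in> closure W \<Longrightarrow> \<zeta> \<notin> W \<Longrightarrow> e > 0 \<Longrightarrow>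
      eventually (\<lambda>z. u z < c + e) (at \<zeta> within W)"
    and infinity: "\<And>e. e > 0 \<Longrightarrow> eventually (\<lambda>z. z \<in> W \<longrightarrow> u z < c + e) at_infinity"
    and z0: "z0 \<in> W"
  shows "u z0 \<le> c"
proof (rule ccontr)
  assume "\<not> u z0 \<le> c"
  define e where "e = (u z0 - c) / 2"
  have "e > 0" using \<open>\<not> u z0 \<le> c\<close> by (simp add: e_def)
  define K where "K = {z\<in>W. c + e \<le> u z}"
  have "z0 \<in> K" using z0 \<open>e > 0\<close> by (auto simp: K_def e_def field_simps)
  obtain b where b: "\<And>z. norm z \<ge> b \<Longrightarrow> z \<in> W \<Longrightarrow> u z < c + e"
    using infinity[OF \<open>e > 0\<close>] unfolding eventually_at_infinity by blast
  define R where "R = \<bar>b\<bar> + 1"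
  have KR: "norm z < R" if "z \<in> K" for z
    using b[of z] that by (force simp: K_def R_def)
  have "bounded K" using KR by (intro boundedI[of _ R]) force
  moreover have "closed K"
    unfolding closed_sequential_limits
  proof (intro allI impI, elim conjE)
    fix x l assume x: "\<forall>n. x n \<in> K" and lim: "x \<longlonglongrightarrow> l"
    show "l \<in> K"
    proof (cases "l \<in> W")
      case True
      have "(\<lambda>n. u (x n)) \<longlonglongrightarrow> u l"
        using harmonic_on_imp_isCont[OF u True] lim isCont_tendsto_compose by blast
      then have "c + e \<le> u l"
        using x by (intro LIMSEQ_le_const) (auto simp: K_def)
      then show ?thesis using True by (simp add: K_def)
    next
      case False
      have "l \<in> closure W"
        using x lim unfolding closure_sequential K_def by blast
      from boundary[OF this False \<open>e > 0\<close>]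
      have "eventually (\<lambda>z. u z < c + e) (at l within W)" .
      moreover have "filterlim x (at l within W) sequentially"
        using x lim False unfolding filterlim_at K_def by (auto intro!: always_eventually)
      ultimately have "eventually (\<lambda>n. u (x n) < c + e) sequentially"
        by (rule eventually_compose_filterlim)
      then obtain n where "u (x n) < c + e"
        by (auto simp: eventually_sequentially)
      then show ?thesis using x unfolding K_def by (smt (verit) mem_Collect_eq)
    qed
  qed
  ultimately have "compact K" by (simp add: compact_eq_bounded_closed)
  \<comment> \<open>On the disc of radius \<open>R + 1\<close>, which contains all points within distance \<open>1\<close> of \<open>K\<close>, the
      perturbation is at most \<open>e\<close>, too little to lift points outside \<open>K\<close> above \<open>u z0 = c + 2 e\<close>.\<close>
  define \<eta> where "\<eta> = e / (R + 1)^2"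
  have "R > 0" by (simp add: R_def)
  then have "\<eta> > 0" using \<open>e > 0\<close> by (simp add: \<eta>_def)
  define v where "v z = u z + \<eta> * (norm z)^2" for z
  have "continuous_on K v"
    unfolding v_def
    by (intro continuous_intros continuous_at_imp_continuous_on)
      (auto simp: K_def intro: harmonic_on_imp_isCont[OF u])
  then obtain z1 where z1: "z1 \<in> K" "\<And>z. z \<in> K \<Longrightarrow> v z \<le> v z1"
    using continuous_attains_sup[OF \<open>compact K\<close>, of v] \<open>z0 \<in> K\<close> by blast
  have "z1 \<in> W" using z1 by (simp add: K_def)
  then obtain r where r: "r > 0" "ball z1 r \<subseteq> W"
    using harmonic_on_imp_open[OF u] open_contains_ball by blast
  have "v w \<le> v z1" if w: "dist z1 w < min r 1" for w
  proof (cases "w \<in> K")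
    case False
    have "w \<in> W" using w r by auto
    then have "u w < c + e" using False by (auto simp: K_def)
    have "norm w \<le> norm z1 + dist z1 w"
      using norm_triangle_ineq2[of w z1] by (simp add: dist_norm norm_minus_commute)
    then have "norm w \<le> R + 1" using KR[OF z1(1)] w by simp
    then have "(norm w)^2 \<le> (R + 1)^2" by (intro power_mono) auto
    then have "\<eta> * (norm w)^2 \<le> \<eta> * (R + 1)^2" using \<open>\<eta> > 0\<close> by simp
    also have "\<dots> = e" using \<open>R > 0\<close> by (simp add: \<eta>_def)
    finally have "v w < c + e + e" using \<open>u w < c + e\<close> by (simp add: v_def)
    also have "\<dots> = u z0" by (simp add: e_def)
    also have "\<dots> \<le> v z0" using \<open>\<eta> > 0\<close> by (simp add: v_def)
    also have "\<dots> \<le> v z1" using z1 \<open>z0 \<in> K\<close> by blast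
    finally show ?thesis by simp
  qed (use z1 in blast)
  then show False
    using harmonic_plus_square_no_local_max[OF u \<open>z1 \<in> W\<close> \<open>\<eta> > 0\<close>, of "min r 1"] r
    by (simp add: v_def)
qed

section \<open>The polynomial hull\<close>

lemma bdd_above_norm_poly_image:
  "compact E \<Longrightarrow> bdd_above ((\<lambda>w. norm (poly p w)) ` E)" for p :: "complex poly"
  by (intro compact_imp_bounded[THEN bounded_imp_bdd_above] compact_continuous_image continuous_intros)

lemma subset_polynomial_hull: "compact E \<Longrightarrow> E \<subseteq> polynomial_hull E"
  unfolding polynomial_hull_def by (auto intro!: cSUP_upper bdd_above_norm_poly_image)

text \<open>
  For \<open>w\<close> outside the hull some polynomial \<open>p\<close> has \<open>p w = 1\<close> and \<open>|p| \<le> r < 1\<close> on the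
  hull. Then \<open>(1 - p^n) / (x - w)\<close> is a polynomial in \<open>x\<close> and converges uniformly on the hull to
  \<open>1 / (x - w)\<close>. So \<open>1 / (x - w)\<close> also satisfies the inequality defining the hull, which is the
  claim. In particular the boundary of the hull lies in \<open>E\<close>.
\<close>

lemma infdist_le_dist_hull:
  assumes "compact E" "E \<noteq> {}" and \<zeta>: "\<zeta> \<in> polynomial_hull E" and w: "w \<notin> polynomial_hull E"
  shows "infdist w E \<le> dist w \<zeta>"
proof -
  have "w \<noteq> \<zeta>" using \<zeta> w by blast
  define D where "D = infdist w E"
  have "w \<notin> E" using subset_polynomial_hull \<open>compact E\<close> w by blast
  then have "D > 0"
    unfolding D_def using assms compact_imp_closed infdist_pos_not_in_closed by blast
  obtain p0 where p0: "(SUP x\<in>E. norm (poly p0 x)) < norm (poly p0 w)"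
    using w unfolding polynomial_hull_def by (auto simp: not_le)
  have "norm (poly p0 x) < norm (poly p0 w)" if "x \<in> E" for x
    using cSUP_upper[OF that bdd_above_norm_poly_image[OF \<open>compact E\<close>]] p0 by (rule le_less_trans)
  define p where "p = smult (1 / poly p0 w) p0"
  define r where "r = (SUP x\<in>E. norm (poly p0 x)) / norm (poly p0 w)"
  obtain x0 where "x0 \<in> E" using \<open>E \<noteq> {}\<close> by blast
  have s0: "0 \<le> (SUP x\<in>E. norm (poly p0 x))"
    using cSUP_upper[OF \<open>x0 \<in> E\<close> bdd_above_norm_poly_image[OF \<open>compact E\<close>], of p0]
    by (rule order_trans[OF norm_ge_zero])
  then have pw: "norm (poly p0 w) > 0" using p0 by linarith
  then have r: "0 \<le> r" "r < 1" using s0 p0 by (auto simp: r_def)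
  have hull_r: "norm (poly p x) \<le> r" if "x \<in> polynomial_hull E" for x
    using that pw unfolding polynomial_hull_def p_def r_def
    by (auto simp: norm_mult norm_divide divide_right_mono)
  have "poly p w = 1" using pw by (simp add: p_def)
  have ineq: "(1 - r^n) * D \<le> (1 + r^n) * dist w \<zeta>" for n
  proof -
    have "poly (1 - p ^ n) w = 0" using \<open>poly p w = 1\<close> by simp
    then obtain h where h: "1 - p ^ n = [:-w, 1:] * h"
      by (metis poly_eq_0_iff_dvd dvdE)
    have hx: "1 - poly p x ^ n = (x - w) * poly h x" for x
      using arg_cong[OF h, of "\<lambda>q. poly q x"] by (simp add: algebra_simps)
    have pn: "norm (poly p x ^ n) \<le> r ^ n" if "x \<in> polynomial_hull E" for x
      using hull_r[OF that] by (simp add: norm_power power_mono)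
    have "norm (poly h x) \<le> (1 + r^n) / D" if "x \<in> E" for x
    proof -
      have "D * norm (poly h x) \<le> dist w x * norm (poly h x)"
        unfolding D_def by (intro mult_right_mono infdist_le that) auto
      also have "\<dots> = norm (1 - poly p x ^ n)"
        using hx[of x] by (simp add: norm_mult dist_norm norm_minus_commute)
      also have "\<dots> \<le> 1 + r ^ n"
        using norm_triangle_ineq4[of 1 "poly p x ^ n"] pn[of x] that
          subset_polynomial_hull[OF \<open>compact E\<close>] by force
      finally show ?thesis using \<open>D > 0\<close> by (simp add: field_simps)
    qed
    then have "(SUP x\<in>E. norm (poly h x)) \<le> (1 + r^n) / D"
      using \<open>E \<noteq> {}\<close> by (intro cSUP_least) auto
    then have h\<zeta>: "norm (poly h \<zeta>) \<le> (1 + r^n) / D"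
      using \<zeta> unfolding polynomial_hull_def by (auto intro: order_trans)
    have "1 - r ^ n \<le> norm (1 - poly p \<zeta> ^ n)"
      using norm_triangle_ineq2[of 1 "poly p \<zeta> ^ n"] pn[OF \<zeta>] by simp
    also have "\<dots> = dist w \<zeta> * norm (poly h \<zeta>)"
      using hx[of \<zeta>] by (simp add: norm_mult dist_norm norm_minus_commute)
    also have "\<dots> \<le> dist w \<zeta> * ((1 + r^n) / D)"
      by (intro mult_left_mono h\<zeta>) auto
    finally show ?thesis using \<open>D > 0\<close> by (simp add: field_simps)
  qed
  have "(\<lambda>n. (1 - r^n) * D) \<longlonglongrightarrow> (1 - 0) * D" "(\<lambda>n. (1 + r^n) * dist w \<zeta>) \<longlonglongrightarrow> (1 + 0) * dist w \<zeta>"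
    using r by (intro tendsto_intros LIMSEQ_realpow_zero; simp)+
  from LIMSEQ_le[OF this] ineq show ?thesis by (auto simp: D_def)
qed

section \<open>The Green function\<close>

lemma green_is_green_function: "regular_set E \<Longrightarrow> is_green_function E (green E)"
  unfolding regular_set_def green_def using someI_ex[of "is_green_function E"] by blast

lemma is_green_functionD:
  assumes "is_green_function E g"
  shows "g harmonic_on (- polynomial_hull E)"
    and "z \<notin> polynomial_hull E \<Longrightarrow> g z > 0"
    and "\<exists>l. ((\<lambda>z. g z - ln (norm z)) \<longlongrightarrow> l) at_infinity"
    and "z \<in> polynomial_hull E \<Longrightarrow> g z = 0"
  using assms unfolding is_green_function_def by (auto simp: Let_def)

lemma is_green_function_nonneg: "is_green_function E g \<Longrightarrow> g z \<ge> 0"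
  using is_green_functionD(2,4) by (cases "z \<in> polynomial_hull E") (force intro: less_imp_le)+

text \<open>
  The Green function vanishes on the hull, so near \<open>E\<close> the Lojasiewicz-Siciak inequality
  excludes points of the hull outside \<open>E\<close>. Therefore the rest of the hull, \<open>F\<close>, is closed. It is
  open too, since boundary points of the hull lie in \<open>E\<close>. As the plane is connected and \<open>E\<close>
  is nonempty, \<open>F\<close> is empty.
\<close>

lemma lojasiewicz_siciak_polynomial_hull:
  assumes "E \<noteq> {}" and ls: "lojasiewicz_siciak E"
  shows "polynomial_hull E = E"
proof -
  have cE: "compact E" and reg: "regular_set E"
    using ls by (auto simp: lojasiewicz_siciak_def)
  note gr = is_green_functionD[OF green_is_green_function[OF reg]]
  obtain U B \<beta> where U: "E \<subseteq> interior U" and "B > 0" "\<beta> > 0"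
    and g: "\<And>z. z \<in> U \<Longrightarrow> B * infdist z E powr \<beta> \<le> green E z"
    using ls unfolding lojasiewicz_siciak_def by blast
  have hullU: "z \<in> E" if z: "z \<in> polynomial_hull E" "z \<in> U" for z
  proof (rule ccontr)
    assume "z \<notin> E"
    then have "infdist z E > 0"
      using cE \<open>E \<noteq> {}\<close> compact_imp_closed infdist_pos_not_in_closed by blast
    then have "B * infdist z E powr \<beta> > 0" using \<open>B > 0\<close> by simp
    then show False using g[OF z(2)] gr(4)[OF z(1)] by simp
  qed
  define F where "F = polynomial_hull E - E"
  have clH: "closed (polynomial_hull E)"
    using harmonic_on_imp_open[OF gr(1)] by (simp add: closed_def)
  have "F = polynomial_hull E - interior U"
    using U hullU interior_subset by (auto simp: F_def)
  then have "closed F" using clH by (simp add: closed_Diff)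
  moreover have "open F"
    unfolding open_contains_ball
  proof
    fix y assume y: "y \<in> F"
    define D where "D = infdist y E"
    have "D > 0"
      unfolding D_def using y cE \<open>E \<noteq> {}\<close> compact_imp_closed infdist_pos_not_in_closed
      by (auto simp: F_def)
    \<comment> \<open>Within \<open>D / 2\<close> of \<open>y\<close>, the set \<open>E\<close> is farther away than the point \<open>y\<close> of the hull.\<close>
    have "w \<in> F" if w: "dist y w < D / 2" for w
    proof -
      have *: "D \<le> infdist w E + dist y w"
        unfolding D_def using infdist_triangle[of y E w] by simp
      then have "infdist w E > dist w y" using w by (simp add: dist_commute)
      then have "w \<in> polynomial_hull E"
        using infdist_le_dist_hull[OF cE \<open>E \<noteq> {}\<close>, of y w] y by (force simp: F_def)
      moreover have "w \<notin> E" using * w \<open>D > 0\<close> by auto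
      ultimately show ?thesis by (simp add: F_def)
    qed
    then show "\<exists>e>0. ball y e \<subseteq> F" using \<open>D > 0\<close>
      by (intro exI[of _ "D/2"]) auto
  qed
  ultimately have "F = {} \<or> F = UNIV" using clopen by blast
  then have "F = {}" using \<open>E \<noteq> {}\<close> by (auto simp: F_def)
  then show ?thesis using subset_polynomial_hull[OF cE] by (auto simp: F_def)
qed

lemma filterlim_ln_norm_at_infinity: "filterlim (\<lambda>z::complex. ln (norm z)) at_top at_infinity"
  by (rule filterlim_compose[OF ln_at_top filterlim_norm_at_top])

lemma tendsto_ln_norm_poly_at_infinity:
  fixes p :: "complex poly"
  assumes "p \<noteq> 0"
  shows "((\<lambda>z. ln (norm (poly p z)) - degree p * ln (norm z)) \<longlongrightarrow> ln (norm (lead_coeff p))) at_infinity"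
proof -
  have lim: "((\<lambda>z. ln (norm (poly p z / z ^ degree p))) \<longlongrightarrow> ln (norm (lead_coeff p))) at_infinity"
    using assms by (intro tendsto_ln tendsto_norm poly_divide_tendsto_aux) auto
  have "eventually (\<lambda>z. norm (poly p z / z ^ degree p) > 0) at_infinity"
    using order_tendstoD(1)[OF tendsto_norm[OF poly_divide_tendsto_aux[of p]], of 0] assms by simp
  with eventually_not_equal_at_infinity[of 0]
  have "eventually (\<lambda>z. ln (norm (poly p z / z ^ degree p))
      = ln (norm (poly p z)) - degree p * ln (norm z)) at_infinity"
    by eventually_elim (auto simp: norm_divide norm_power ln_div ln_realpow)
  with lim show ?thesis by (rule Lim_transform_eventually)
qed

text \<open>
  The maximum principle for \<open>log |p| - k g\<close>, where \<open>k\<close> is the degree. The function is bounded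
  at infinity, but its limit there is not known to be small; replacing \<open>k\<close> by \<open>k + \<eta>\<close> with
  \<open>\<eta> > 0\<close> makes it tend to \<open>-\<infinity>\<close>, and \<open>\<eta>\<close> tends to \<open>0\<close> at the end.
\<close>

lemma bernstein_walsh:
  fixes p :: "complex poly" and g :: "complex \<Rightarrow> real"
  assumes g: "is_green_function E g" and "M > 0"
    and M: "\<And>w. w \<in> polynomial_hull E \<Longrightarrow> norm (poly p w) \<le> M"
  shows "norm (poly p z) \<le> M * exp (degree p * g z)"
proof (cases "z \<in> polynomial_hull E \<or> poly p z = 0")
  case True
  then show ?thesis
    using M[of z] is_green_functionD(4)[OF g, of z] \<open>M > 0\<close> by auto
next
  case False
  note gr = is_green_functionD[OF g]
  define W where "W = - polynomial_hull E - {z. poly p z = 0}"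
  have "p \<noteq> 0" using False by auto
  then have oW: "open W"
    unfolding W_def using harmonic_on_imp_open[OF gr(1)] poly_roots_finite
    by (intro open_Diff finite_imp_closed) auto
  have zW: "z \<in> W" using False by (auto simp: W_def)
  have bound: "ln (norm (poly p z)) - (real (degree p) + \<eta>) * g z \<le> ln M" if "\<eta> > 0" for \<eta> :: real
  proof -
    define u where "u z = 1 * ln (norm (poly p z)) + (- (real (degree p) + \<eta>)) * g z" for z
    have "u harmonic_on W"
      unfolding u_def
      by (intro harmonic_on_lincomb harmonic_on_ln_norm_poly oW harmonic_on_subset[OF gr(1) oW])
        (auto simp: W_def)
    then have "u z \<le> ln M"
    proof (rule harmonic_max_principle[OF _ _ _ zW])
      fix \<zeta> and e :: real assume \<zeta>: "\<zeta> \<in> closure W" "\<zeta> \<notin> W" and "e > 0"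
      have small: "norm (poly p \<zeta>) < M * exp e"
      proof (cases "\<zeta> \<in> polynomial_hull E")
        case True
        have "M < M * exp e" using \<open>e > 0\<close> \<open>M > 0\<close> by simp
        then show ?thesis using M[OF True] by simp
      qed (use \<zeta> \<open>M > 0\<close> in \<open>auto simp: W_def\<close>)
      have "((\<lambda>z. norm (poly p z)) \<longlongrightarrow> norm (poly p \<zeta>)) (at \<zeta> within W)"
        by (intro tendsto_intros)
      from order_tendstoD(2)[OF this small]
      have "eventually (\<lambda>z. norm (poly p z) < M * exp e) (at \<zeta> within W)" .
      moreover have "eventually (\<lambda>z. z \<in> W) (at \<zeta> within W)"
        by (auto simp: eventually_at_filter)
      ultimately show "eventually (\<lambda>z. u z < ln M + e) (at \<zeta> within W)"
      proof eventually_elim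
        case (elim z)
        have "ln (norm (poly p z)) < ln (M * exp e)"
          using elim \<open>M > 0\<close> by (subst ln_less_cancel_iff) (auto simp: W_def)
        also have "\<dots> = ln M + e" using \<open>M > 0\<close> by (simp add: ln_mult)
        finally show ?case
          using is_green_function_nonneg[OF g, of z] \<open>\<eta> > 0\<close> unfolding u_def
          by (smt (verit) mult_nonneg_nonneg of_nat_0_le_iff mult_minus_left)
      qed
    next
      fix e :: real assume "e > 0"
      obtain l where l: "((\<lambda>z. g z - ln (norm z)) \<longlongrightarrow> l) at_infinity" using gr(3) by blast
      have "((\<lambda>z. (ln (norm (poly p z)) - degree p * ln (norm z)) - (real (degree p) + \<eta>) * (g z - ln (norm z)))
        \<longlongrightarrow> ln (norm (lead_coeff p)) - (real (degree p) + \<eta>) * l) at_infinity"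
        by (intro tendsto_intros l tendsto_ln_norm_poly_at_infinity \<open>p \<noteq> 0\<close>)
      moreover have "filterlim (\<lambda>z::complex. - \<eta> * ln (norm z)) at_bot at_infinity"
        using \<open>\<eta> > 0\<close>
        by (intro filterlim_tendsto_neg_mult_at_bot[OF tendsto_const _ filterlim_ln_norm_at_infinity]) auto
      ultimately have "filterlim (\<lambda>z. (ln (norm (poly p z)) - degree p * ln (norm z))
          - (real (degree p) + \<eta>) * (g z - ln (norm z)) + (- \<eta> * ln (norm z))) at_bot at_infinity"
        by (subst filterlim_tendsto_add_at_bot_iff)
      then have "filterlim u at_bot at_infinity"
        by (simp add: u_def[abs_def] algebra_simps)
      then have "eventually (\<lambda>z. u z < ln M + e) at_infinity"
        by (auto simp: filterlim_at_bot_dense)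
      then show "eventually (\<lambda>z. z \<in> W \<longrightarrow> u z < ln M + e) at_infinity"
        by eventually_elim auto
    qed
    then show ?thesis by (simp add: u_def algebra_simps)
  qed
  have gz: "g z > 0" using gr(2)[of z] False by auto
  have "ln (norm (poly p z)) \<le> ln M + degree p * g z"
  proof (rule field_le_epsilon)
    fix e :: real assume "e > 0"
    have "(degree p + e / g z) * g z = degree p * g z + e" using gz by (simp add: field_simps)
    then show "ln (norm (poly p z)) \<le> ln M + degree p * g z + e"
      using bound[of "e / g z"] gz \<open>e > 0\<close> by (simp add: algebra_simps)
  qed
  then have "exp (ln (norm (poly p z))) \<le> exp (ln M + degree p * g z)" by simp
  then show ?thesis using False \<open>M > 0\<close> by (simp add: exp_add)
qed

section \<open>Nearly Fekete sets\<close>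

definition node_poly :: "complex set \<Rightarrow> complex poly" where
  "node_poly S = (\<Prod>x\<in>S. [:- x, 1:])"

text \<open>
  The absolute value of the discriminant of the set, that is, the square of the absolute value of
  the Vandermonde determinant of its points.
\<close>

definition distance_product :: "complex set \<Rightarrow> real" where
  "distance_product S = (\<Prod>x\<in>S. \<Prod>y\<in>S - {x}. dist x y)"

lemma norm_node_poly: "norm (poly (node_poly S) z) = (\<Prod>x\<in>S. dist z x)"
  by (simp add: node_poly_def poly_prod dist_norm flip: prod_norm)

lemma degree_node_poly: "finite S \<Longrightarrow> degree (node_poly S) = card S"
  unfolding node_poly_def by (subst degree_prod_sum_eq) auto

lemma node_poly_eq_0_iff: "finite S \<Longrightarrow> poly (node_poly S) z = 0 \<longleftrightarrow> z \<in> S"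
  by (simp add: node_poly_def poly_prod)

lemma node_poly_nonzero: "finite S \<Longrightarrow> node_poly S \<noteq> 0"
  by (simp add: node_poly_def)

lemma distance_product_insert:
  assumes "finite T" "x \<notin> T"
  shows "distance_product (insert x T) = distance_product T * (\<Prod>y\<in>T. dist x y)^2"
proof -
  have "(\<Prod>y\<in>insert x T - {a}. dist a y) = dist x a * (\<Prod>y\<in>T - {a}. dist a y)" if "a \<in> T" for a
  proof -
    have "insert x T - {a} = insert x (T - {a})" using that assms by auto
    then show ?thesis using assms by (simp add: dist_commute)
  qed
  then have "(\<Prod>a\<in>T. \<Prod>y\<in>insert x T - {a}. dist a y)
      = (\<Prod>a\<in>T. dist x a) * distance_product T"
    by (simp add: distance_product_def prod.distrib)
  moreover have "insert x T - {x} = T" using assms by auto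
  ultimately show ?thesis
    using assms by (simp add: distance_product_def power2_eq_square)
qed

text \<open>
  Fekete sets maximise \<open>distance_product\<close>. A set that reaches a quarter of the supremum has
  the same property up to the factor \<open>2\<close>: exchanging \<open>x\<close> for \<open>w\<close> multiplies the product by
  the square of the quotient of the two sides, so this square is at most \<open>4\<close>.
\<close>

lemma near_fekete_set_exists:
  fixes E :: "complex set"
  assumes "infinite E" "bounded E"
  obtains S where "S \<subseteq> E" "finite S" "card S = m"
    "\<And>x w. x \<in> S \<Longrightarrow> w \<in> E \<Longrightarrow> (\<Prod>y\<in>S - {x}. dist w y) \<le> 2 * (\<Prod>y\<in>S - {x}. dist x y)"
proof -
  define F where "F = {S. S \<subseteq> E \<and> finite S \<and> card S = m}"
  obtain S0 where S0: "S0 \<in> F"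
    using infinite_arbitrarily_large[OF \<open>infinite E\<close>, of m] by (auto simp: F_def)
  obtain d0 where d0: "\<And>x y. x \<in> E \<Longrightarrow> y \<in> E \<Longrightarrow> dist x y \<le> d0"
    using \<open>bounded E\<close> bounded_two_points by metis
  define d where "d = max 1 d0"
  have bound: "distance_product S \<le> (d ^ m) ^ m" if "S \<in> F" for S
  proof -
    have S: "S \<subseteq> E" "finite S" "card S = m" using that by (auto simp: F_def)
    have "(\<Prod>y\<in>S - {x}. dist x y) \<le> d ^ m" if "x \<in> S" for x
    proof -
      have "(\<Prod>y\<in>S - {x}. dist x y) \<le> (\<Prod>y\<in>S - {x}. d)"
        using d0 S that by (intro prod_mono) (auto simp: d_def intro!: max.coboundedI2)
      also have "\<dots> \<le> d ^ m"
        using S that by (auto simp: d_def intro!: power_increasing)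
      finally show ?thesis .
    qed
    then have "distance_product S \<le> (\<Prod>x\<in>S. d ^ m)"
      unfolding distance_product_def by (intro prod_mono) (auto intro: prod_nonneg)
    then show ?thesis using S by simp
  qed
  have pos: "distance_product S > 0" if "S \<in> F" for S
    unfolding distance_product_def using that by (auto simp: F_def intro!: prod_pos)
  have bdd: "bdd_above (distance_product ` F)" using bound by (auto intro!: bdd_aboveI)
  define L where "L = (SUP S\<in>F. distance_product S)"
  have "L > 0" unfolding L_def using cSUP_upper[OF S0 bdd] pos[OF S0] by linarith
  then have "L / 4 < L" by simp
  then obtain S where S: "S \<in> F" "L / 4 < distance_product S"
    unfolding L_def using less_cSUP_iff[OF _ bdd] S0 by (metis empty_iff)
  have SE: "S \<subseteq> E" "finite S" "card S = m" using S by (auto simp: F_def)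
  have "(\<Prod>y\<in>S - {x}. dist w y) \<le> 2 * (\<Prod>y\<in>S - {x}. dist x y)" if x: "x \<in> S" and w: "w \<in> E" for x w
  proof (cases "w \<in> S - {x}")
    case True
    then have "(\<Prod>y\<in>S - {x}. dist w y) = 0" using SE by (auto intro!: prod_zero)
    moreover have "0 \<le> (\<Prod>y\<in>S - {x}. dist x y)" by (auto intro: prod_nonneg)
    ultimately show ?thesis by linarith
  next
    case False
    define T where "T = S - {x}"
    have T: "finite T" "x \<notin> T" "w \<notin> T" "S = insert x T" using SE x False by (auto simp: T_def)
    have "card (insert w T) = card (insert x T)" using T by simp
    then have wF: "insert w T \<in> F" using SE T w by (auto simp: F_def)
    have T0: "distance_product T > 0"
      unfolding distance_product_def using T by (auto intro!: prod_pos)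
    have "distance_product (insert w T) \<le> L"
      unfolding L_def by (rule cSUP_upper[OF wF bdd])
    also have "L \<le> 4 * distance_product (insert x T)" using S T by simp
    finally have "distance_product T * (\<Prod>y\<in>T. dist w y)^2
        \<le> distance_product T * (2 * (\<Prod>y\<in>T. dist x y))^2"
      using T by (simp add: distance_product_insert power_mult_distrib)
    then have "(\<Prod>y\<in>T. dist w y)^2 \<le> (2 * (\<Prod>y\<in>T. dist x y))^2"
      using T0 by simp
    then show ?thesis
      unfolding T_def[symmetric] by (rule power2_le_imp_le) (auto intro: prod_nonneg)
  qed
  with SE show ?thesis by (rule that)
qed

text \<open>
  As a function of \<open>z\<close>, the sum is the polynomial of degree less than \<open>card S\<close> that takes the
  value \<open>1\<close> at every point of \<open>S\<close>.
\<close>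

lemma sum_lagrange_basis_eq_1:
  fixes z :: "'a :: field"
  assumes "finite S" "S \<noteq> {}"
  shows "(\<Sum>x\<in>S. \<Prod>y\<in>S - {x}. (z - y) / (x - y)) = 1"
proof -
  define lag where "lag x = (\<Prod>y\<in>S - {x}. smult (1 / (x - y)) [:- y, 1:])" for x
  have poly_lag: "poly (lag x) z = (\<Prod>y\<in>S - {x}. (z - y) / (x - y))" for x z
    by (simp add: lag_def poly_prod diff_divide_distrib)
  have "(\<Sum>x\<in>S. lag x) = 1"
  proof (rule poly_eqI_degree[of S])
    fix z assume "z \<in> S"
    have "poly (lag x) z = (if x = z then 1 else 0)" if "x \<in> S" for x
      using that \<open>z \<in> S\<close> \<open>finite S\<close> unfolding poly_lag
      by (auto intro!: prod.neutral prod_zero)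
    then show "poly (\<Sum>x\<in>S. lag x) z = poly 1 z"
      using \<open>finite S\<close> \<open>z \<in> S\<close> by (simp add: poly_sum)
  next
    have "degree (lag x) \<le> card S - 1" if "x \<in> S" for x
    proof -
      have "degree (lag x) \<le> (\<Sum>y\<in>S - {x}. degree (smult (1 / (x - y)) [:- y, 1:]))"
        unfolding lag_def using degree_prod_sum_le[of "S - {x}" "\<lambda>y. smult (1 / (x - y)) [:- y, 1:]"] \<open>finite S\<close>
        unfolding o_def by blast
      also have "\<dots> \<le> (\<Sum>y\<in>S - {x}. 1)" by (intro sum_mono) auto
      finally show ?thesis using that \<open>finite S\<close> by simp
    qed
    then have "degree (\<Sum>x\<in>S. lag x) \<le> card S - 1"
      using \<open>finite S\<close> by (intro degree_sum_le) auto
    moreover have "card S > 0" using assms by (simp add: card_gt_0_iff)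
    ultimately show "degree (\<Sum>x\<in>S. lag x) < card S" "degree (1 :: 'a poly) < card S" by auto
  qed
  then have "poly (\<Sum>x\<in>S. lag x) z = 1" by simp
  then show ?thesis by (simp add: poly_sum poly_lag)
qed

text \<open>
  In the identity \<open>1 = \<Sum>x\<in>S. \<omega> z / ((z - x) * \<omega>' x)\<close> each denominator is large: \<open>|z - x| \<ge> \<delta>\<close>
  by assumption, and the near Fekete property gives
  \<open>|\<omega> w| = |w - x| * |\<omega> w / (w - x)| \<le> 2 d |\<omega>' x|\<close> for every \<open>w\<close> in \<open>E\<close>.
\<close>

lemma near_fekete_node_poly_lower:
  fixes d \<delta> :: real
  assumes S: "S \<subseteq> E" "finite S" "S \<noteq> {}"
    and fek: "\<And>x w. x \<in> S \<Longrightarrow> w \<in> E \<Longrightarrow> (\<Prod>y\<in>S - {x}. dist w y) \<le> 2 * (\<Prod>y\<in>S - {x}. dist x y)"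
    and d: "\<And>x y. x \<in> E \<Longrightarrow> y \<in> E \<Longrightarrow> dist x y \<le> d"
    and \<delta>: "\<delta> > 0" "\<delta> \<le> infdist z E" and w: "w \<in> E"
  shows "\<delta> * norm (poly (node_poly S) w) \<le> 2 * d * card S * norm (poly (node_poly S) z)"
proof -
  have one: "1 \<le> (\<Sum>x\<in>S. \<Prod>y\<in>S - {x}. dist z y / dist x y)"
  proof -
    have "1 = norm (\<Sum>x\<in>S. \<Prod>y\<in>S - {x}. (z - y) / (x - y))"
      using sum_lagrange_basis_eq_1[OF S(2,3), of z] by simp
    also have "\<dots> \<le> (\<Sum>x\<in>S. norm (\<Prod>y\<in>S - {x}. (z - y) / (x - y)))" by (rule norm_sum)
    finally show ?thesis by (simp add: norm_divide dist_norm flip: prod_norm)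
  qed
  have "d \<ge> 0" using d[OF w w] by simp
  have summand: "\<delta> * norm (poly (node_poly S) w) * (\<Prod>y\<in>S - {x}. dist z y / dist x y)
      \<le> 2 * d * norm (poly (node_poly S) z)" if x: "x \<in> S" for x
  proof -
    \<comment> \<open>Here \<open>P = |\<omega>' x|\<close>, and \<open>Q\<close>, \<open>R\<close> are the absolute values of \<open>\<omega> / (_ - x)\<close> at \<open>z\<close> and \<open>w\<close>.\<close>
    define P Q R where "P = (\<Prod>y\<in>S - {x}. dist x y)" and "Q = (\<Prod>y\<in>S - {x}. dist z y)"
      and "R = (\<Prod>y\<in>S - {x}. dist w y)"
    have "P > 0" "Q \<ge> 0" "R \<ge> 0" unfolding P_def Q_def R_def
      by (auto intro!: prod_pos prod_nonneg)
    have "\<delta> \<le> dist z x" using \<delta> infdist_le[of x E z] S x by auto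
    have "dist w x \<le> d" using d w S x by blast
    have "R \<le> 2 * P" using fek[OF x w] by (simp add: P_def R_def)
    have "\<delta> * (dist w x * R) * (Q / P) \<le> dist z x * (d * (2 * P)) * (Q / P)"
      using \<open>\<delta> > 0\<close> \<open>\<delta> \<le> dist z x\<close> \<open>dist w x \<le> d\<close> \<open>R \<le> 2 * P\<close> \<open>P > 0\<close> \<open>Q \<ge> 0\<close> \<open>R \<ge> 0\<close> \<open>d \<ge> 0\<close>
      by (intro mult_right_mono mult_mono) auto
    also have "\<dots> = 2 * d * (dist z x * Q)" using \<open>P > 0\<close> by simp
    finally show ?thesis
      using S x by (simp add: norm_node_poly prod.remove[of S x] P_def Q_def R_def prod_dividef)
  qed
  have "\<delta> * norm (poly (node_poly S) w) * 1
      \<le> \<delta> * norm (poly (node_poly S) w) * (\<Sum>x\<in>S. \<Prod>y\<in>S - {x}. dist z y / dist x y)"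
    using \<delta> by (intro mult_left_mono one) auto
  also have "\<dots> = (\<Sum>x\<in>S. \<delta> * norm (poly (node_poly S) w) * (\<Prod>y\<in>S - {x}. dist z y / dist x y))"
    by (rule sum_distrib_left)
  also have "\<dots> \<le> (\<Sum>x\<in>S. 2 * d * norm (poly (node_poly S) z))"
    by (rule sum_mono) (rule summand)
  finally show ?thesis by (simp add: mult_ac)
qed

text \<open>
  If \<open>E\<close> were finite, the polynomial with zero set \<open>E\<close> would be bounded on \<open>E\<close> by every positive
  \<open>M\<close>, and the Bernstein-Walsh inequality would make it vanish identically.
\<close>

lemma green_function_infinite:
  assumes g: "is_green_function E g" and hull: "polynomial_hull E = E"
  shows "infinite E"
proof
  assume "finite E"
  then obtain z where "z \<notin> E" using ex_new_if_finite[OF infinite_UNIV_char_0] by blast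
  define q where "q = norm (poly (node_poly E) z)"
  define X where "X = exp (degree (node_poly E) * g z)"
  have "q > 0" "X > 0"
    using node_poly_eq_0_iff[OF \<open>finite E\<close>, of z] \<open>z \<notin> E\<close> by (auto simp: q_def X_def)
  then have "q / (2 * X) > 0" by simp
  moreover have "norm (poly (node_poly E) w) \<le> q / (2 * X)" if "w \<in> polynomial_hull E" for w
  proof -
    have "poly (node_poly E) w = 0"
      using that node_poly_eq_0_iff[OF \<open>finite E\<close>] by (simp add: hull)
    then show ?thesis using \<open>q / (2 * X) > 0\<close> by simp
  qed
  ultimately have "q \<le> q / (2 * X) * X"
    unfolding q_def X_def by (rule bernstein_walsh[OF g])
  then show False using \<open>q > 0\<close> \<open>X > 0\<close> by simp
qed

text \<open>
  The counterpart of \<open>bernstein_walsh\<close>: the maximum principle for \<open>(k - \<eta>) g - log |p|\<close>, which is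
  harmonic off \<open>E\<close> since \<open>p\<close> has its zeros there, on the set of points at distance more than \<open>\<delta>\<close>
  from \<open>E\<close>. Again \<open>\<eta>\<close> forces the limit \<open>-\<infinity>\<close> at infinity.
\<close>

lemma green_lower_bound_poly:
  fixes p :: "complex poly" and g :: "complex \<Rightarrow> real" and G L \<delta> :: real
  assumes g: "is_green_function E g" and hull: "polynomial_hull E = E" and "E \<noteq> {}"
    and roots: "\<And>z. poly p z = 0 \<Longrightarrow> z \<in> E" and "p \<noteq> 0"
    and "\<delta> > 0" and G: "\<And>z. infdist z E = \<delta> \<Longrightarrow> g z \<le> G"
    and "L > 0" and L: "\<And>z. infdist z E = \<delta> \<Longrightarrow> L \<le> norm (poly p z)"
    and z: "\<delta> \<le> infdist z E"
  shows "L * exp (degree p * (g z - G)) \<le> norm (poly p z)"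
proof (cases "infdist z E = \<delta>")
  case True
  have "degree p * (g z - G) \<le> 0" using G[OF True] by (simp add: mult_nonneg_nonpos)
  then have "L * exp (degree p * (g z - G)) \<le> L * 1" using \<open>L > 0\<close> by (intro mult_left_mono) auto
  then show ?thesis using L[OF True] by simp
next
  case False
  note gr = is_green_functionD[OF g, unfolded hull]
  define W where "W = {z. \<delta> < infdist z E}"
  have zW: "z \<in> W" using False z by (simp add: W_def)
  have oW: "open W" unfolding W_def by (intro open_Collect_less continuous_intros)
  have notE: "z \<notin> E" if "\<delta> \<le> infdist z E" for z using that \<open>\<delta> > 0\<close> by auto
  have WE: "W \<subseteq> - E" using notE by (force simp: W_def)
  define c where "c = degree p * G - ln L"
  have bound: "(degree p - \<eta>) * g z - ln (norm (poly p z)) \<le> c" if "\<eta> > 0" for \<eta> :: real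
  proof -
    define u where "u z = (degree p - \<eta>) * g z + (- 1) * ln (norm (poly p z))" for z
    have "u harmonic_on W"
      unfolding u_def using roots WE
      by (intro harmonic_on_lincomb harmonic_on_ln_norm_poly oW harmonic_on_subset[OF gr(1) oW]) auto
    then have "u z \<le> c"
    proof (rule harmonic_max_principle[OF _ _ _ zW])
      fix \<zeta> and e :: real assume \<zeta>: "\<zeta> \<in> closure W" "\<zeta> \<notin> W" and "e > 0"
      have "closed {z. \<delta> \<le> infdist z E}" by (intro closed_Collect_le continuous_intros)
      then have "closure W \<subseteq> {z. \<delta> \<le> infdist z E}"
        by (intro closure_minimal) (auto simp: W_def)
      then have dist: "infdist \<zeta> E = \<delta>" using \<zeta> by (force simp: W_def)
      then have nz: "poly p \<zeta> \<noteq> 0" and "\<zeta> \<in> - E" using notE roots by auto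
      then have "isCont g \<zeta>" using harmonic_on_imp_isCont[OF gr(1)] by blast
      then have "isCont u \<zeta>" unfolding u_def using nz by (intro continuous_intros) auto
      then have lim: "(u \<longlongrightarrow> u \<zeta>) (at \<zeta> within W)"
        using continuous_at_imp_continuous_at_within continuous_within by blast
      have "ln L \<le> ln (norm (poly p \<zeta>))"
        using L[OF dist] \<open>L > 0\<close> nz by simp
      moreover have "degree p * g \<zeta> \<le> degree p * G"
        using G[OF dist] by (intro mult_left_mono) auto
      moreover have "\<eta> * g \<zeta> \<ge> 0"
        using \<open>\<eta> > 0\<close> is_green_function_nonneg[OF g] by simp
      ultimately have "u \<zeta> < c + e" using \<open>e > 0\<close> by (simp add: u_def c_def algebra_simps)
      with lim show "eventually (\<lambda>z. u z < c + e) (at \<zeta> within W)"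
        by (rule order_tendstoD(2))
    next
      fix e :: real assume "e > 0"
      obtain l where l: "((\<lambda>z. g z - ln (norm z)) \<longlongrightarrow> l) at_infinity" using gr(3) by blast
      have "((\<lambda>z. (degree p - \<eta>) * (g z - ln (norm z)) - (ln (norm (poly p z)) - degree p * ln (norm z)))
        \<longlongrightarrow> (degree p - \<eta>) * l - ln (norm (lead_coeff p))) at_infinity"
        by (intro tendsto_intros l tendsto_ln_norm_poly_at_infinity \<open>p \<noteq> 0\<close>)
      moreover have "filterlim (\<lambda>z::complex. - \<eta> * ln (norm z)) at_bot at_infinity"
        using \<open>\<eta> > 0\<close>
        by (intro filterlim_tendsto_neg_mult_at_bot[OF tendsto_const _ filterlim_ln_norm_at_infinity]) auto
      ultimately have "filterlim (\<lambda>z. (degree p - \<eta>) * (g z - ln (norm z))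
          - (ln (norm (poly p z)) - degree p * ln (norm z)) + (- \<eta> * ln (norm z))) at_bot at_infinity"
        by (subst filterlim_tendsto_add_at_bot_iff)
      then have "filterlim u at_bot at_infinity"
        by (simp add: u_def[abs_def] algebra_simps)
      then have "eventually (\<lambda>z. u z < c + e) at_infinity"
        by (auto simp: filterlim_at_bot_dense)
      then show "eventually (\<lambda>z. z \<in> W \<longrightarrow> u z < c + e) at_infinity"
        by eventually_elim auto
    qed
    then show ?thesis by (simp add: u_def algebra_simps)
  qed
  have gz: "g z > 0" using gr(2)[of z] notE[OF z] by auto
  have "degree p * g z - ln (norm (poly p z)) \<le> c"
  proof (rule field_le_epsilon)
    fix e :: real assume "e > 0"
    have "(degree p - e / g z) * g z = degree p * g z - e" using gz by (simp add: field_simps)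
    then show "degree p * g z - ln (norm (poly p z)) \<le> c + e"
      using bound[of "e / g z"] gz \<open>e > 0\<close> by simp
  qed
  then have "ln L + degree p * (g z - G) \<le> ln (norm (poly p z))"
    by (simp add: c_def algebra_simps)
  then have "exp (ln L + degree p * (g z - G)) \<le> exp (ln (norm (poly p z)))" by simp
  moreover have "poly p z \<noteq> 0" using roots notE[OF z] by auto
  ultimately show ?thesis using \<open>L > 0\<close> by (simp add: exp_add)
qed

section \<open>Growth of the Green function\<close>

lemma green_filterlim_at_infinity:
  assumes g: "is_green_function E g" and "c < 1"
  shows "filterlim (\<lambda>z. g z - c * ln (norm z)) at_top at_infinity"
proof -
  obtain l where "((\<lambda>z. g z - ln (norm z)) \<longlongrightarrow> l) at_infinity"
    using is_green_functionD(3)[OF g] by blast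
  moreover have "filterlim (\<lambda>z::complex. (1 - c) * ln (norm z)) at_top at_infinity"
    using \<open>c < 1\<close>
    by (intro filterlim_tendsto_pos_mult_at_top[OF tendsto_const _ filterlim_ln_norm_at_infinity]) auto
  ultimately have "filterlim (\<lambda>z. (g z - ln (norm z)) + (1 - c) * ln (norm z)) at_top at_infinity"
    by (rule filterlim_tendsto_add_at_top)
  then show ?thesis by (simp add: algebra_simps)
qed

lemma green_ge_half_ln:
  assumes "is_green_function E g"
  shows "\<exists>R>0. \<forall>z. R \<le> norm (z - a) \<longrightarrow> ln (norm (z - a)) / 2 \<le> g z"
proof -
  have "eventually (\<lambda>z. g z - (1/2) * ln (norm z) \<ge> ln 2 / 2) at_infinity"
    by (rule filterlim_at_top[THEN iffD1, rule_format, OF green_filterlim_at_infinity[OF assms]]) simp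
  then obtain b where b: "\<And>z. norm z \<ge> b \<Longrightarrow> g z - (1/2) * ln (norm z) \<ge> ln 2 / 2"
    by (auto simp: eventually_at_infinity)
  have "ln (norm (z - a)) / 2 \<le> g z" if z: "\<bar>b\<bar> + 2 * norm a + 1 \<le> norm (z - a)" for z
  proof -
    have n: "norm (z - a) \<le> norm z + norm a" by (rule norm_triangle_ineq4)
    have *: "norm z \<ge> b" "norm a \<le> norm z" "0 < norm z"
      using z n norm_ge_zero[of a] by linarith+
    have "norm (z - a) > 0" using z norm_ge_zero[of a] by linarith
    then have "z \<noteq> a" by simp
    then have "ln (norm (z - a)) \<le> ln (2 * norm z)"
      using n * by (subst ln_le_cancel_iff) auto
    also have "\<dots> = ln 2 + ln (norm z)" using *(3) by (simp add: ln_mult)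
    finally show ?thesis using b[OF *(1)] by simp
  qed
  then show ?thesis
    by (intro exI[of _ "\<bar>b\<bar> + 2 * norm a + 1"]) (auto intro: add_nonneg_pos)
qed

text \<open>
  Away from the neighbourhood \<open>U\<close> of \<open>E\<close> the Green function is bounded below by a positive
  constant, by compactness and its growth at infinity. Since \<open>\<epsilon> powr \<beta> \<le> 1\<close>, a smaller
  constant makes the inequality valid in the whole plane.
\<close>

lemma lojasiewicz_siciak_global:
  assumes "E \<noteq> {}" and ls: "lojasiewicz_siciak E"
  obtains B \<beta> where "B > 0" "\<beta> > 0"
    "\<And>\<epsilon> z. 0 < \<epsilon> \<Longrightarrow> \<epsilon> \<le> 1 \<Longrightarrow> \<epsilon> \<le> infdist z E \<Longrightarrow> B * \<epsilon> powr \<beta> \<le> green E z"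
proof -
  have hull: "polynomial_hull E = E" using lojasiewicz_siciak_polynomial_hull[OF assms] .
  have isg: "is_green_function E (green E)"
    using ls by (auto simp: lojasiewicz_siciak_def intro: green_is_green_function)
  note gr = is_green_functionD[OF isg, unfolded hull]
  obtain U B0 \<beta> where U: "E \<subseteq> interior U" and "B0 > 0" "\<beta> > 0"
    and g: "\<And>z. z \<in> U \<Longrightarrow> B0 * infdist z E powr \<beta> \<le> green E z"
    using ls unfolding lojasiewicz_siciak_def by blast
  have "eventually (\<lambda>z. green E z \<ge> 1) at_infinity"
    using green_filterlim_at_infinity[OF isg, of 0] by (simp add: filterlim_at_top)
  then obtain b where b: "\<And>z. norm z \<ge> b \<Longrightarrow> green E z \<ge> 1"
    by (auto simp: eventually_at_infinity)
  define K where "K = cball 0 b \<inter> - interior U"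
  have K: "compact K" unfolding K_def by (intro compact_Int_closed) auto
  have KE: "z \<notin> E" if "z \<in> K" for z using that U by (auto simp: K_def)
  have cont: "continuous_on K (green E)"
    using KE harmonic_on_imp_isCont[OF gr(1)] by (auto intro!: continuous_at_imp_continuous_on)
  obtain c where c: "c > 0" "\<And>z. z \<in> K \<Longrightarrow> c \<le> green E z"
  proof (cases "K = {}")
    case False
    then obtain z1 where "z1 \<in> K" "\<And>z. z \<in> K \<Longrightarrow> green E z1 \<le> green E z"
      using continuous_attains_inf[OF K _ cont] by blast
    then show ?thesis using that[of "green E z1"] gr(2) KE by blast
  qed (use that[of 1] in auto)
  define B where "B = min B0 (min 1 c)"
  have "B > 0" using \<open>B0 > 0\<close> c by (simp add: B_def)
  moreover have "B * \<epsilon> powr \<beta> \<le> green E z" if \<epsilon>: "0 < \<epsilon>" "\<epsilon> \<le> 1" "\<epsilon> \<le> infdist z E" for \<epsilon> z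
  proof (cases "z \<in> U")
    case True
    have "B * \<epsilon> powr \<beta> \<le> B0 * infdist z E powr \<beta>"
      using \<epsilon> \<open>\<beta> > 0\<close> \<open>B > 0\<close> by (intro mult_mono powr_mono2) (auto simp: B_def)
    then show ?thesis using g[OF True] by simp
  next
    case False
    then have "z \<notin> interior U" using interior_subset by blast
    then have "min 1 c \<le> green E z"
      using b[of z] c(2)[of z] by (cases "norm z \<ge> b") (auto simp: K_def)
    moreover have "B * \<epsilon> powr \<beta> \<le> B * 1"
      using \<epsilon> \<open>\<beta> > 0\<close> \<open>B > 0\<close> powr_mono2[of \<beta> \<epsilon> 1] by (intro mult_left_mono) auto
    moreover have "B \<le> min 1 c" unfolding B_def by (rule min.cobounded2)
    ultimately show ?thesis by linarith
  qed
  ultimately show ?thesis using that \<open>\<beta> > 0\<close> by blast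
qed

section \<open>The approximating polynomials\<close>

text \<open>
  The numerical conditions say what the degree must achieve: \<open>m s\<close>, the size of \<open>m g\<close> at distance
  \<open>\<epsilon>\<close>, has to dominate \<open>log (1 / \<delta>)\<close>, \<open>log m\<close> and \<open>m G\<close>. Half of \<open>m g\<close> pays for the
  losses, and the other half makes the orbits escape. From \<open>|z - a| \<ge> R\<close> on, logarithmic growth
  of \<open>g\<close> and \<open>m \<ge> 8\<close> give \<open>|P z - a| \<ge> |z - a|^2 \<ge> 2 |z - a|\<close>.
\<close>

lemma filled_julia_approximation:
  fixes E :: "complex set" and g :: "complex \<Rightarrow> real" and m :: nat
    and d \<delta> \<epsilon> G s R :: real
  assumes cE: "compact E" and a: "a \<in> E" and g: "is_green_function E g"
    and hull: "polynomial_hull E = E"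
    and d: "d > 0" "\<And>x y. x \<in> E \<Longrightarrow> y \<in> E \<Longrightarrow> dist x y \<le> d"
    and \<delta>: "0 < \<delta>" "\<delta> \<le> \<epsilon>" and G: "\<And>z. infdist z E \<le> \<delta> \<Longrightarrow> g z \<le> G"
    and s: "\<And>z. \<epsilon> \<le> infdist z E \<Longrightarrow> s \<le> g z"
    and R: "2 \<le> R" "\<And>z. R \<le> norm (z - a) \<Longrightarrow> \<epsilon> \<le> infdist z E"
      "\<And>z. R \<le> norm (z - a) \<Longrightarrow> ln (norm (z - a)) / 2 \<le> g z"
    and m: "8 \<le> m" "4 * d * m * exp (2 * (m * G)) / \<delta>^2 \<le> exp (m * s / 2)" "R \<le> exp (m * s / 2)"
  obtains P where "degree P = m" "E \<subseteq> filled_julia P"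
    "\<And>z. z \<in> filled_julia P \<Longrightarrow> infdist z E < \<epsilon>"
proof -
  have "E \<noteq> {}" using a by blast
  have "infinite E" by (rule green_function_infinite[OF g hull])
  obtain S where S: "S \<subseteq> E" "finite S" "card S = m" and
    fek: "\<And>x w. x \<in> S \<Longrightarrow> w \<in> E \<Longrightarrow> (\<Prod>y\<in>S - {x}. dist w y) \<le> 2 * (\<Prod>y\<in>S - {x}. dist x y)"
    using near_fekete_set_exists[OF \<open>infinite E\<close> compact_imp_bounded[OF cE], of m] by metis
  have "S \<noteq> {}" using S m by auto
  define \<omega> where "\<omega> = node_poly S"
  have deg: "degree \<omega> = m" unfolding \<omega>_def using degree_node_poly S by simp
  have "\<omega> \<noteq> 0" unfolding \<omega>_def by (rule node_poly_nonzero) fact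
  have "continuous_on E (\<lambda>z. norm (poly \<omega> z))" by (intro continuous_intros)
  from continuous_attains_sup[OF cE \<open>E \<noteq> {}\<close> this]
  obtain w0 where w0: "w0 \<in> E" "\<And>w. w \<in> E \<Longrightarrow> norm (poly \<omega> w) \<le> norm (poly \<omega> w0)" by blast
  define M where "M = norm (poly \<omega> w0)"
  have M: "\<And>w. w \<in> E \<Longrightarrow> norm (poly \<omega> w) \<le> M" using w0(2) by (simp add: M_def)
  obtain w1 where "w1 \<in> E" "w1 \<notin> S" using \<open>infinite E\<close> \<open>finite S\<close> finite_subset[of E S] by auto
  then have "norm (poly \<omega> w1) > 0" using node_poly_eq_0_iff[OF \<open>finite S\<close>] by (simp add: \<omega>_def)
  then have "M > 0" using M[OF \<open>w1 \<in> E\<close>] by linarith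
  have m0: "real m > 0" using m by simp
  have upper: "norm (poly \<omega> z) \<le> M * exp (m * G)" if "infdist z E \<le> \<delta>" for z
  proof -
    have "norm (poly \<omega> z) \<le> M * exp (degree \<omega> * g z)"
      by (rule bernstein_walsh[OF g \<open>M > 0\<close>]) (simp add: hull M)
    also have "\<dots> \<le> M * exp (m * G)"
      using G[OF that] \<open>M > 0\<close> by (simp add: deg mult_left_mono)
    finally show ?thesis .
  qed
  define L where "L = M * \<delta> / (2 * d * m)"
  have "L > 0" using \<open>M > 0\<close> d \<delta> m0 by (simp add: L_def)
  have L: "L \<le> norm (poly \<omega> z)" if "infdist z E = \<delta>" for z
  proof -
    have "\<delta> * norm (poly \<omega> w0) \<le> 2 * d * card S * norm (poly \<omega> z)"
      unfolding \<omega>_def using that \<delta>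
      by (intro near_fekete_node_poly_lower[OF S(1,2) \<open>S \<noteq> {}\<close> fek d(2) _ _ w0(1)]) auto
    then show ?thesis using d m0 S by (simp add: L_def M_def field_simps)
  qed
  have lower: "L * exp (m * (g z - G)) \<le> norm (poly \<omega> z)" if "\<delta> \<le> infdist z E" for z
    unfolding deg[symmetric]
    by (rule green_lower_bound_poly[OF g hull \<open>E \<noteq> {}\<close> _ \<open>\<omega> \<noteq> 0\<close> \<delta>(1) _ \<open>L > 0\<close> L that])
      (use S node_poly_eq_0_iff[OF \<open>finite S\<close>] G in \<open>auto simp: \<omega>_def\<close>)
  \<comment> \<open>This factor makes \<open>c \<omega>\<close> at most \<open>\<delta> / 2\<close> where the distance to \<open>E\<close> is at most \<open>\<delta>\<close>.\<close>
  define c where "c = \<delta> / (2 * (M * exp (m * G)))"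
  have "c > 0" using \<delta> \<open>M > 0\<close> by (simp add: c_def)
  define P where "P = [:a:] + smult c (\<omega>)"
  have Pz: "poly P z - a = c * poly \<omega> z" for z by (simp add: P_def)
  then have nPz: "norm (poly P z - a) = c * norm (poly \<omega> z)" for z
    using \<open>c > 0\<close> by (simp add: norm_mult)
  have "degree P = m"
    using deg m \<open>c > 0\<close> unfolding P_def by (subst degree_add_eq_right) auto
  have near: "norm (poly P z - a) \<le> \<delta> / 2" if "infdist z E \<le> \<delta>" for z
  proof -
    have "norm (poly P z - a) \<le> c * (M * exp (m * G))"
      unfolding nPz using upper[OF that] \<open>c > 0\<close> by simp
    also have "\<dots> = \<delta> / 2" using \<open>M > 0\<close> by (simp add: c_def)
    finally show ?thesis .
  qed
  have in_julia: "E \<subseteq> filled_julia P"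
  proof
    fix z assume "z \<in> E"
    have iter: "infdist ((poly P ^^ n) z) E \<le> \<delta>" for n
    proof (induction n)
      case 0
      show ?case using \<open>z \<in> E\<close> \<delta> by simp
    next
      case (Suc n)
      have "infdist (poly P ((poly P ^^ n) z)) E \<le> dist (poly P ((poly P ^^ n) z)) a"
        by (rule infdist_le[OF a])
      also have "\<dots> \<le> \<delta>" using near[OF Suc] \<delta> by (simp add: dist_norm)
      finally show ?case by simp
    qed
    have "(poly P ^^ n) z \<in> cball a (\<delta> / 2)" if "n \<ge> 1" for n
      using that near[OF iter[of "n - 1"]]
      by (cases n) (auto simp: dist_norm norm_minus_commute)
    then have "(\<lambda>n. (poly P ^^ n) z) ` {1..} \<subseteq> cball a (\<delta> / 2)" by auto
    then show "z \<in> filled_julia P"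
      unfolding filled_julia_def using bounded_subset[OF bounded_cball] by blast
  qed
  have expand: "exp (m * g z / 2) \<le> norm (poly P z - a)" if z: "\<epsilon> \<le> infdist z E" for z
  proof -
    have exp_sq: "exp (2 * (m * G)) = exp (m * G) * exp (m * G)" by (simp flip: exp_add)
    have "exp (m * s / 2) \<le> exp (m * g z / 2)" using s[OF z] m0 by simp
    then have "4 * d * m * exp (2 * (m * G)) / \<delta>^2 \<le> exp (m * g z / 2)" using m(2) by linarith
    then have "exp (m * g z / 2) * (4 * d * m * exp (2 * (m * G)) / \<delta>^2)
        \<le> exp (m * g z / 2) * exp (m * g z / 2)"
      by (intro mult_left_mono) auto
    also have "\<dots> = exp (m * g z)" by (simp flip: exp_add)
    finally have "exp (m * g z / 2) \<le> exp (m * g z) * \<delta>^2 / (4 * d * m * exp (2 * (m * G)))"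
      using \<delta> d m0 by (simp add: field_simps)
    also have "\<dots> = c * (L * exp (m * (g z - G)))"
      unfolding c_def L_def right_diff_distrib exp_diff exp_sq using \<open>M > 0\<close>
      by (simp add: power2_eq_square mult_ac)
    also have "\<dots> \<le> norm (poly P z - a)"
      unfolding nPz using lower[of z] z \<delta> \<open>c > 0\<close> by simp
    finally show ?thesis .
  qed
  have escape: "infdist z E < \<epsilon>" if "z \<in> filled_julia P" for z
  proof (rule ccontr)
    assume "\<not> infdist z E < \<epsilon>"
    then have z: "\<epsilon> \<le> infdist z E" by simp
    have grow: "R * 2 ^ n \<le> norm ((poly P ^^ Suc n) z - a)" for n
    proof (induction n)
      case 0
      have "R \<le> exp (m * g z / 2)"
        by (rule order_trans[OF m(3)]) (use s[OF z] m0 in simp)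
      then show ?case using expand[OF z] by simp
    next
      case (Suc n)
      define x where "x = (poly P ^^ Suc n) z"
      have x: "R * 2 ^ n \<le> norm (x - a)" using Suc by (simp add: x_def)
      have "R * 1 \<le> R * 2 ^ n" using R(1) by (intro mult_left_mono) auto
      then have xR: "R \<le> norm (x - a)" using x by simp
      have "R * 2 ^ Suc n \<le> 2 * norm (x - a)" using x by simp
      also have "\<dots> \<le> norm (x - a) * norm (x - a)"
        using xR R(1) by (intro mult_right_mono) auto
      also have "\<dots> = exp (2 * ln (norm (x - a)))"
      proof -
        have "0 < norm (x - a)" using xR R(1) by linarith
        then have "exp (ln (norm (x - a))) = norm (x - a)" by (rule exp_ln)
        then show ?thesis by (simp only: exp_double power2_eq_square)
      qed
      also have "\<dots> \<le> exp (m * g x / 2)"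
      proof -
        have "ln (norm (x - a)) \<ge> 0" using xR R(1) by simp
        then have "8 * (ln (norm (x - a)) / 2) \<le> m * g x"
          using R(3)[OF xR] m(1) by (intro mult_mono) auto
        then show ?thesis by simp
      qed
      also have "\<dots> \<le> norm (poly P x - a)" by (rule expand[OF R(2)[OF xR]])
      finally show ?case by (simp add: x_def)
    qed
    have "bounded ((\<lambda>n. (poly P ^^ n) z) ` {1..})" using that by (simp add: filled_julia_def)
    then obtain C where "\<forall>x\<in>(\<lambda>n. (poly P ^^ n) z) ` {1..}. norm x \<le> C"
      unfolding bounded_iff by blast
    then have C: "norm ((poly P ^^ n) z) \<le> C" if "n \<ge> 1" for n using that by blast
    obtain n where n: "C + norm a < 2 ^ n" using real_arch_pow[of 2 "C + norm a"] by auto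
    have "2 ^ n \<le> R * 2 ^ n" using R(1) by simp
    also have "\<dots> \<le> norm ((poly P ^^ Suc n) z - a)" by (rule grow)
    also have "\<dots> \<le> norm ((poly P ^^ Suc n) z) + norm a" by (rule norm_triangle_ineq4)
    also have "\<dots> \<le> C + norm a" using C[of "Suc n"] by simp
    finally show False using n by simp
  qed
  show ?thesis by (rule that[OF \<open>degree P = m\<close> in_julia escape])
qed

lemma hausdorff_dist_le:
  assumes "E \<noteq> {}" "E \<subseteq> K" "\<And>z. z \<in> K \<Longrightarrow> infdist z E \<le> \<epsilon>" "\<epsilon> \<ge> 0"
  shows "hausdorff_dist E K \<le> \<epsilon>"
  unfolding hausdorff_dist_def
proof (rule max.boundedI)
  show "(SUP x\<in>E. infdist x K) \<le> \<epsilon>"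
    using assms by (intro cSUP_least) (auto simp: subset_iff)
  show "(SUP y\<in>K. infdist y E) \<le> \<epsilon>"
    using assms by (intro cSUP_least) auto
qed

lemma powr_le_exp_sqrt:
  fixes b c p :: real
  assumes "b > 0" "c > 0"
  shows "eventually (\<lambda>m::nat. c * real m powr p \<le> exp (b * real m powr (1/2))) sequentially"
  using assms by real_asymp

text \<open>
  Taking \<open>\<epsilon> = m^(-\<kappa>)\<close> with \<open>\<kappa> = 1 / (2 \<beta>)\<close> makes \<open>m \<epsilon>^\<beta>\<close> equal
  to the square root of \<open>m\<close>, and \<open>\<delta> = m^(-q)\<close> with \<open>q = 1 / \<alpha> + \<kappa>\<close> is small enough both for
  \<open>m \<delta>^\<alpha> \<le> 1\<close> and for \<open>\<delta> \<le> \<epsilon>\<close>.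
\<close>

lemma filled_julia_rate:
  fixes E :: "complex set"
  assumes cE: "compact E" and "E \<noteq> {}" and g: "is_green_function E g"
    and hull: "polynomial_hull E = E"
    and ls: "B > 0" "\<beta> > 0"
      "\<And>\<epsilon> z. 0 < \<epsilon> \<Longrightarrow> \<epsilon> \<le> 1 \<Longrightarrow> \<epsilon> \<le> infdist z E \<Longrightarrow> B * \<epsilon> powr \<beta> \<le> g z"
    and \<alpha>: "0 < \<alpha>" "\<alpha> \<le> 1" and A: "A > 0"
      "\<And>\<delta> z. 0 < \<delta> \<Longrightarrow> infdist z E < \<delta> \<Longrightarrow> g z \<le> A * \<delta> powr \<alpha>"
  shows "eventually (\<lambda>m. \<exists>P. degree P = m \<and>
    hausdorff_dist E (filled_julia P) \<le> real m powr (- 1 / (2 * \<beta>))) sequentially"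
proof -
  obtain a where a: "a \<in> E" using \<open>E \<noteq> {}\<close> by blast
  obtain d0 where d0: "\<And>x y. x \<in> E \<Longrightarrow> y \<in> E \<Longrightarrow> dist x y \<le> d0"
    using compact_imp_bounded[OF cE] bounded_two_points by metis
  define d where "d = max 1 d0"
  have d: "d > 0" "\<And>x y. x \<in> E \<Longrightarrow> y \<in> E \<Longrightarrow> dist x y \<le> d"
    using d0 by (auto simp: d_def intro: max.coboundedI2)
  obtain R0 where R0: "\<And>z. R0 \<le> norm (z - a) \<Longrightarrow> ln (norm (z - a)) / 2 \<le> g z"
    using green_ge_half_ln[OF g, of a] by blast
  define R where "R = max R0 (d + 2)"
  have R: "2 \<le> R" "R0 \<le> R" "d + 1 \<le> R" using d(1) by (auto simp: R_def)
  have far: "1 \<le> infdist z E" if "R \<le> norm (z - a)" for z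
  proof -
    have "1 \<le> dist z x" if "x \<in> E" for x
      using dist_triangle[of z a x] d(2)[OF that a] \<open>R \<le> norm (z - a)\<close> R by (simp add: dist_norm)
    then show ?thesis
      unfolding infdist_def using \<open>E \<noteq> {}\<close> by (auto intro: cINF_greatest)
  qed
  define \<kappa> where "\<kappa> = 1 / (2 * \<beta>)"
  define q where "q = 1 / \<alpha> + \<kappa>"
  have "\<kappa> > 0" using ls by (simp add: \<kappa>_def)
  have q: "1 \<le> q * \<alpha>" "\<kappa> \<le> q" using \<alpha> \<open>\<kappa> > 0\<close> by (auto simp: q_def field_simps)
  have ev1: "eventually (\<lambda>m::nat. (4 * d * exp (4 * A)) * real m powr (1 + 2 * q)
      \<le> exp (B / 2 * real m powr (1/2))) sequentially"
    using d ls by (intro powr_le_exp_sqrt) auto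
  have ev2: "eventually (\<lambda>m::nat. R * real m powr 0 \<le> exp (B / 2 * real m powr (1/2))) sequentially"
    using R ls by (intro powr_le_exp_sqrt) auto
  show ?thesis
    using ev1 ev2 eventually_ge_at_top[of 8]
  proof eventually_elim
    case (elim m)
    have m0: "real m > 0" and m1: "real m \<ge> 1" using elim by auto
    define \<epsilon> \<delta> s G where "\<epsilon> = real m powr (- \<kappa>)" and "\<delta> = real m powr (- q)"
      and "s = B * \<epsilon> powr \<beta>" and "G = 2 * A / m"
    have \<epsilon>: "0 < \<epsilon>" "\<epsilon> \<le> 1"
      using m0 m1 \<open>\<kappa> > 0\<close> powr_mono[of "- \<kappa>" 0 m] by (auto simp: \<epsilon>_def)
    have \<delta>: "0 < \<delta>" "\<delta> \<le> \<epsilon>"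
      using m0 m1 q(2) by (auto simp: \<delta>_def \<epsilon>_def intro!: powr_mono)
    have G: "g z \<le> G" if "infdist z E \<le> \<delta>" for z
    proof -
      \<comment> \<open>The Hoelder condition has a strict inequality, hence the factor \<open>2\<close>.\<close>
      have "g z \<le> A * (2 * \<delta>) powr \<alpha>" using that \<delta> by (intro A) auto
      also have "(2 * \<delta>) powr \<alpha> = 2 powr \<alpha> * \<delta> powr \<alpha>" using \<delta> by (simp add: powr_mult)
      also have "\<dots> \<le> 2 powr 1 * m powr (- 1)"
        unfolding \<delta>_def powr_powr using \<alpha> q m1 by (intro mult_mono powr_mono) auto
      also have "A * \<dots> = G" using m0 by (simp add: G_def powr_minus field_simps)
      finally show ?thesis using A(1) by simp
    qed
    have "real m * s = B * (real m powr 1 * real m powr (- \<kappa> * \<beta>))"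
      using m0 by (simp add: s_def \<epsilon>_def powr_powr)
    also have "\<dots> = B * real m powr (1/2)"
      using powr_add[of "real m" 1 "- \<kappa> * \<beta>"] ls by (simp add: \<kappa>_def)
    finally have ms: "real m * s / 2 = B / 2 * real m powr (1/2)" by simp
    have mG: "real m * G = 2 * A" using m0 by (simp add: G_def)
    have \<delta>2: "\<delta>^2 = 1 / real m powr (2 * q)"
      using m0 by (simp add: \<delta>_def power2_eq_square powr_minus_divide flip: powr_add)
    have "exp (2 * (real m * G)) = exp (4 * A)" by (simp add: mG)
    then have "4 * d * m * exp (2 * (m * G)) / \<delta>^2 = (4 * d * exp (4 * A)) * real m powr (1 + 2 * q)"
      using m0 by (simp only: \<delta>2 powr_add) simp
    then have num1: "4 * d * m * exp (2 * (m * G)) / \<delta>^2 \<le> exp (m * s / 2)"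
      using elim(1) ms by simp
    have num2: "R \<le> exp (m * s / 2)" using elim(2) ms m0 by simp
    have sz: "s \<le> g z" if "\<epsilon> \<le> infdist z E" for z
      unfolding s_def using ls(3)[OF \<epsilon> that] .
    have R2: "\<epsilon> \<le> infdist z E" if "R \<le> norm (z - a)" for z using far[OF that] \<epsilon> by simp
    have R3: "ln (norm (z - a)) / 2 \<le> g z" if "R \<le> norm (z - a)" for z
      using R0[of z] that R by simp
    obtain P where P: "degree P = m" "E \<subseteq> filled_julia P"
      "\<And>z. z \<in> filled_julia P \<Longrightarrow> infdist z E < \<epsilon>"
      using filled_julia_approximation[OF cE a g hull d \<delta> G sz R(1) R2 R3 elim(3) num1 num2]
      by blast
    have "hausdorff_dist E (filled_julia P) \<le> \<epsilon>"
      using P \<epsilon> \<open>E \<noteq> {}\<close> by (intro hausdorff_dist_le) (auto intro: less_imp_le)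
    then show ?case using P(1) by (auto simp: \<epsilon>_def \<kappa>_def)
  qed
qed

theorem proposition1p4:
  fixes E :: "complex set"
  assumes "compact E" and "E \<noteq> {}"
    and "lojasiewicz_siciak E"
  shows "\<exists>C \<kappa> :: real. C > 0 \<and> \<kappa> > 0 \<and>
           (\<forall>\<alpha> :: real. 0 < \<alpha> \<and> \<alpha> \<le> 1 \<and> (\<exists>A. green_holder E A \<alpha>) \<longrightarrow>
             (\<exists>N :: nat. \<forall>n\<ge>N. \<exists>P :: complex poly. degree P = n + 1 \<and>
                (1/2 \<le> \<alpha> \<longrightarrow>
                   hausdorff_dist E (filled_julia P) \<le> C * (ln (real n + 1) / real n) powr \<kappa>) \<and>
                (\<alpha> < 1/2 \<longrightarrow>
                   hausdorff_dist E (filled_julia P) \<le> C * real n powr (- 2 * \<alpha> * \<kappa>))))"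
proof -
  obtain B \<beta> where ls: "B > 0" "\<beta> > 0"
    "\<And>\<epsilon> z. 0 < \<epsilon> \<Longrightarrow> \<epsilon> \<le> 1 \<Longrightarrow> \<epsilon> \<le> infdist z E \<Longrightarrow> B * \<epsilon> powr \<beta> \<le> green E z"
    using lojasiewicz_siciak_global[OF assms(2,3)] by blast
  have g: "is_green_function E (green E)"
    using assms(3) by (auto simp: lojasiewicz_siciak_def intro: green_is_green_function)
  have hull: "polynomial_hull E = E" by (rule lojasiewicz_siciak_polynomial_hull[OF assms(2,3)])
  define \<kappa> where "\<kappa> = 1 / (2 * \<beta>)"
  have "\<kappa> > 0" using ls by (simp add: \<kappa>_def)
  have "\<exists>N. \<forall>n\<ge>N. \<exists>P. degree P = n + 1 \<and>
      (1/2 \<le> \<alpha> \<longrightarrow> hausdorff_dist E (filled_julia P) \<le> 1 * (ln (real n + 1) / real n) powr \<kappa>) \<and>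
      (\<alpha> < 1/2 \<longrightarrow> hausdorff_dist E (filled_julia P) \<le> 1 * real n powr (- 2 * \<alpha> * \<kappa>))"
    if \<alpha>: "0 < \<alpha>" "\<alpha> \<le> 1" and "green_holder E A \<alpha>" for \<alpha> A
  proof -
    have A: "A > 0" "\<And>\<delta> z. 0 < \<delta> \<Longrightarrow> infdist z E < \<delta> \<Longrightarrow> green E z \<le> A * \<delta> powr \<alpha>"
      using that(3) by (auto simp: green_holder_def)
    obtain N where N: "\<And>m. m \<ge> N \<Longrightarrow> \<exists>P. degree P = m \<and>
        hausdorff_dist E (filled_julia P) \<le> real m powr (- 1 / (2 * \<beta>))"
      using filled_julia_rate[OF assms(1,2) g hull ls \<alpha> A]
      by (auto simp: eventually_sequentially)
    show ?thesis
    proof (intro exI[of _ "max N 2"] allI impI)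
      fix n assume n: "max N 2 \<le> n"
      then have n2: "real n \<ge> 2" by simp
      obtain P where P: "degree P = n + 1"
        "hausdorff_dist E (filled_julia P) \<le> real (n + 1) powr (- 1 / (2 * \<beta>))"
        using N[of "n + 1"] n by auto
      note P(2)
      also have "real (n + 1) powr (- 1 / (2 * \<beta>)) \<le> real n powr (- \<kappa>)"
        using n2 \<open>\<kappa> > 0\<close> by (simp add: \<kappa>_def powr_mono2')
      finally have h: "hausdorff_dist E (filled_julia P) \<le> real n powr (- \<kappa>)" .
      have "exp 1 \<le> real n + 1" using exp_le n2 by linarith
      then have "1 \<le> ln (real n + 1)" using n2 by (simp add: ln_ge_iff)
      then have "(1 / real n) powr \<kappa> \<le> (ln (real n + 1) / real n) powr \<kappa>"
        using n2 \<open>\<kappa> > 0\<close> by (intro powr_mono2 divide_right_mono) auto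
      moreover have "(1 / real n) powr \<kappa> = real n powr (- \<kappa>)"
        using n2 by (simp add: powr_divide powr_minus_divide)
      moreover have "real n powr (- \<kappa>) \<le> real n powr (- 2 * \<alpha> * \<kappa>)" if "\<alpha> < 1/2"
        using that n2 \<open>\<kappa> > 0\<close> by (intro powr_mono) auto
      ultimately show "\<exists>P. degree P = n + 1 \<and>
          (1/2 \<le> \<alpha> \<longrightarrow> hausdorff_dist E (filled_julia P) \<le> 1 * (ln (real n + 1) / real n) powr \<kappa>) \<and>
          (\<alpha> < 1/2 \<longrightarrow> hausdorff_dist E (filled_julia P) \<le> 1 * real n powr (- 2 * \<alpha> * \<kappa>))"
        using P(1) h by (intro exI[of _ P]) auto
    qed
  qed
  then show ?thesis using \<open>\<kappa> > 0\<close> by (intro exI[of _ 1] exI[of _ \<kappa>]) (auto simp del: mult_1)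
qed

end
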